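(* Let $\alpha>-1$. The inequality $$\int_0^x (x-t)^{\lambda}\,t^{\mu}J_\alpha(t)\,dt\ \ge\ 0\qquad(x>0)$$ holds true under the following case assumptions on $\lambda,\mu\in\mathbb{R}$. (i) If $-1<\alpha\le-1/2$: $\lambda\ge-1/2$ and $-\alpha-1<\mu\le\min\big(\alpha+1,\ \lambda+\alpha\big)$. (ii) If $\alpha\ge-1/2$: $\lambda\ge-1/2$ and either $$-\alpha-1<\mu\le\min\left(-\alpha,\ \lambda-\frac12\right)$$ or $$-\alpha\le\mu\le\min\left[\alpha+1,\ \lambda+\alpha,\ \lambda+\frac12,\ 2\lambda+\frac12,\ \frac12\left(\lambda+\alpha+\frac12\right)\right].$$ Moreover, under these assumptions the inequality is strict for all $x>0$ unless $$(\alpha,\lambda,\mu)=(-1/2,\,1,\,1/2)\quad\text{or}\quad(\alpha,\lambda,\mu)=(1/2,\,0,\,1/2),$$ and the integral in these two exceptional cases reduces to $$\sqrt{\frac2\pi}\int_0^x(x-t)\cos t\,dt=\sqrt{\frac2\pi}\int_0^x\sin t\,dt=2\sqrt{\frac2\pi}\,\sin^2\left(\frac x2\right).$$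
   Context: $J_\alpha$ denotes the Bessel function of the first kind of order $\alpha$. *)

theory Defs
  imports "HOL-Analysis.Analysis"
begin

text \<open>
  The Bessel function of the first kind of real order, for positive real arguments.
  The reciprocal Gamma function is entire, so orders for which the Gamma function
  has a pole need no separate treatment. For \<open>x \<le> 0\<close> the value carries no meaning
  (\<open>powr\<close> is the real power only for a positive base).
\<close>

definition bessel_J :: "real \<Rightarrow> real \<Rightarrow> real" where
  "bessel_J \<alpha> x =
     (\<Sum>k. (-1) ^ k * rGamma (\<alpha> + real k + 1) / fact k * (x / 2) powr (2 * real k + \<alpha>))"

text \<open>
  The values of \<open>powr\<close> at the end points \<open>t = 0\<close> and \<open>t = x\<close> are irrelevant to the
  integrals of this function over \<open>{0..x}\<close>.
\<close>

definition bessel_integrand :: "real \<Rightarrow> real \<Rightarrow> real \<Rightarrow> real \<Rightarrow> real \<Rightarrow> real" where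
  "bessel_integrand \<alpha> lam \<mu> x t = (x - t) powr lam * t powr \<mu> * bessel_J \<alpha> t"

end

theory Submission
  imports Defs
begin

text \<open>
  Termwise integration turns the integral into a positive multiple of a power series in
  \<open>x\<^sup>2\<close>, whose coefficients arise from those of \<open>J\<^bsub>\<nu>\<^esub>\<^sup>2\<close> (nonnegative
  for real arguments) by multiplication with a quotient of Gamma functions
  \<open>\<Prod>\<Gamma>(p\<^sub>i + n) / \<Prod>\<Gamma>(q\<^sub>i + n)\<close>, four factors each. Such a multiplier preserves
  nonnegativity of entire series on \<open>[0, \<infinity>)\<close> as soon as the sums of the \<open>k\<close> smallest \<open>p\<^sub>i\<close>
  do not exceed the sums of the \<open>k\<close> smallest \<open>q\<^sub>i\<close>, and it produces positivity unless the two
  multisets agree. This reduces to quotients with \<open>p < q\<close> and to pairs with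
  \<open>p\<^sub>1 + p\<^sub>2 = q\<^sub>1 + q\<^sub>2\<close>, which are infinite products of the multipliers \<open>1 + k / (p + n)\<close> and
  \<open>1 + k / ((p\<^sub>1 + n) (p\<^sub>2 + n))\<close>. For a suitable \<open>\<nu>\<close> the hypotheses on \<open>(\<alpha>, \<lambda>, \<mu>)\<close>
  imply this majorization.
\<close>

section \<open>Multipliers preserving nonnegativity of entire series\<close>

text \<open>Absolute convergence on the whole line survives bounded factors by comparison; the sign
  matters only for \<open>y \<ge> 0\<close>, the range of the later argument
  \<open>x\<^sup>2 / 4\<close>.\<close>

definition entire_nonneg :: "(nat \<Rightarrow> real) \<Rightarrow> bool" where
  "entire_nonneg c \<longleftrightarrow> (\<forall>y. summable (\<lambda>n. \<bar>c n\<bar> * y ^ n)) \<and> (\<forall>y\<ge>0. 0 \<le> (\<Sum>n. c n * y ^ n))"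

text \<open>The point \<open>y = 0\<close> is included, which forces \<open>c 0 > 0\<close>.\<close>

definition entire_pos :: "(nat \<Rightarrow> real) \<Rightarrow> bool" where
  "entire_pos c \<longleftrightarrow> (\<forall>y. summable (\<lambda>n. \<bar>c n\<bar> * y ^ n)) \<and> (\<forall>y\<ge>0. 0 < (\<Sum>n. c n * y ^ n))"

lemma entire_pos_imp_nonneg: "entire_pos c \<Longrightarrow> entire_nonneg c"
  unfolding entire_pos_def entire_nonneg_def by (auto intro: less_imp_le)

lemma summable_of_abs_coeff:
  fixes c :: "nat \<Rightarrow> real"
  assumes "\<And>y. summable (\<lambda>n. \<bar>c n\<bar> * y ^ n)"
  shows "summable (\<lambda>n. c n * y ^ n)"
proof (rule summable_rabs_cancel)
  show "summable (\<lambda>n. \<bar>c n * y ^ n\<bar>)"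
    using assms[of "\<bar>y\<bar>"] by (simp add: abs_mult power_abs)
qed

lemma entire_nonneg_summable: "entire_nonneg c \<Longrightarrow> summable (\<lambda>n. c n * y ^ n)"
  by (rule summable_of_abs_coeff) (simp add: entire_nonneg_def)

lemma summable_abs_coeff_bounded_mult:
  fixes c m :: "nat \<Rightarrow> real"
  assumes "\<And>y. summable (\<lambda>n. \<bar>c n\<bar> * y ^ n)" and "\<And>n. \<bar>m n\<bar> \<le> K"
  shows "summable (\<lambda>n. \<bar>m n * c n\<bar> * y ^ n)"
proof (rule summable_comparison_test')
  show "summable (\<lambda>n. K * (\<bar>c n\<bar> * \<bar>y\<bar> ^ n))"
    by (intro summable_mult assms)
  fix n :: nat
  have "norm (\<bar>m n * c n\<bar> * y ^ n) = \<bar>m n\<bar> * (\<bar>c n\<bar> * \<bar>y\<bar> ^ n)"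
    by (simp add: abs_mult power_abs)
  also have "\<dots> \<le> K * (\<bar>c n\<bar> * \<bar>y\<bar> ^ n)"
    by (intro mult_right_mono assms) auto
  finally show "norm (\<bar>m n * c n\<bar> * y ^ n) \<le> K * (\<bar>c n\<bar> * \<bar>y\<bar> ^ n)" .
qed

text \<open>The series \<open>g(y) = \<Sum> c\<^sub>n y\<^sup>n / (P + n)\<close> satisfies
  \<open>(y\<^sup>P g(y))' = y\<^sup>P\<^sup>-\<^sup>1 \<Sum> c\<^sub>n y\<^sup>n\<close>.\<close>

lemma entire_divide_shift:
  assumes c: "entire_nonneg c" and P: "P > 0"
  shows "entire_nonneg (\<lambda>n. c n / (P + real n))"
    and "c 0 > 0 \<Longrightarrow> entire_pos (\<lambda>n. c n / (P + real n))"
proof -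
  define d where "d = (\<lambda>n. c n / (P + real n))"
  define F where "F = (\<lambda>y. \<Sum>n. c n * y ^ n)"
  define g where "g = (\<lambda>y. \<Sum>n. d n * y ^ n)"
  have sc: "summable (\<lambda>n. \<bar>c n\<bar> * y ^ n)" for y
    using c by (simp add: entire_nonneg_def)
  have Fnn: "0 \<le> F y" if "y \<ge> 0" for y
    using c that by (simp add: entire_nonneg_def F_def)
  have d_alt: "d = (\<lambda>n. 1 / (P + real n) * c n)" by (simp add: d_def)
  have sd: "summable (\<lambda>n. \<bar>d n\<bar> * y ^ n)" for y
    unfolding d_alt
    by (rule summable_abs_coeff_bounded_mult[OF sc, where K = "1 / P"])
       (use P in \<open>auto simp: field_simps\<close>)
  have sd': "summable (\<lambda>n. d n * y ^ n)" for y
    by (rule summable_of_abs_coeff[OF sd])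
  have sc': "summable (\<lambda>n. c n * y ^ n)" for y
    by (rule summable_of_abs_coeff[OF sc])
  have dg: "(g has_real_derivative (\<Sum>n. diffs d n * y ^ n)) (at y)" for y
    unfolding g_def by (rule termdiffs_strong_converges_everywhere) (rule sd')
  have contF: "isCont F y" for y
    unfolding F_def by (rule isCont_powser_converges_everywhere) (rule sc')
  \<comment> \<open>The Euler operator \<open>P + y d/dy\<close> multiplies the coefficient of
    \<open>y ^ n\<close> by \<open>P + n\<close> and so undoes the division in
    \<open>d\<close>.\<close>
  have ident: "P * g y + y * (\<Sum>n. diffs d n * y ^ n) = F y" for y
  proof -
    have s2: "(\<lambda>n. real n * d n * y ^ n) sums (y * (\<Sum>n. diffs d n * y ^ n))"
    proof -
      have "summable (\<lambda>n. diffs d n * y ^ n)"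
        by (rule termdiff_converges_all) (rule sd')
      then have "(\<lambda>n. real n * d n * y ^ (n - Suc 0)) sums (\<Sum>n. diffs d n * y ^ n)"
        using diffs_equiv[of d y] by simp
      then have "(\<lambda>n. y * (real n * d n * y ^ (n - Suc 0))) sums (y * (\<Sum>n. diffs d n * y ^ n))"
        by (rule sums_mult)
      \<comment> \<open>At \<open>n = 0\<close> the exponent \<open>n - Suc 0\<close> is truncated
        to 0, and the factor \<open>real n\<close> makes both sides vanish.\<close>
      moreover have "y * (real n * d n * y ^ (n - Suc 0)) = real n * d n * y ^ n" for n
        by (cases n) auto
      ultimately show ?thesis by simp
    qed
    have s1: "(\<lambda>n. P * (d n * y ^ n)) sums (P * g y)"
      unfolding g_def by (intro sums_mult summable_sums sd')
    have "(\<lambda>n. P * (d n * y ^ n) + real n * d n * y ^ n) sums (P * g y + y * (\<Sum>n. diffs d n * y ^ n))"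
      by (rule sums_add[OF s1 s2])
    moreover have "P * (d n * y ^ n) + real n * d n * y ^ n = c n * y ^ n" for n
    proof -
      have "P + real n \<noteq> 0" using P by (smt (verit) of_nat_0_le_iff)
      then have "c n = (P + real n) * d n" by (simp add: d_def)
      then show ?thesis by (simp add: algebra_simps)
    qed
    ultimately show ?thesis
      by (simp add: F_def sums_unique)
  qed
  define G where "G = (\<lambda>y. y powr P * g y)"
  have contG: "continuous_on {0..y} G" for y
    unfolding G_def using P
    by (intro continuous_on_mult continuous_on_powr' continuous_intros)
       (auto intro: DERIV_continuous_on has_field_derivative_at_within[OF dg])
  have derG: "(G has_real_derivative (y powr (P - 1) * F y)) (at y)" if "y > 0" for y
  proof -
    have "(G has_real_derivative (P * y powr (P - 1) * g y + (\<Sum>n. diffs d n * y ^ n) * y powr P)) (at y)"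
      unfolding G_def by (rule DERIV_mult[OF has_real_derivative_powr[OF that] dg])
    moreover have "y powr P = y powr (P - 1) * y" using that
      by (metis add.commute diff_add_cancel less_eq_real_def powr_mult_base mult.commute)
    ultimately show ?thesis
      by (simp add: ident[symmetric] algebra_simps)
  qed
  \<comment> \<open>The derivative of \<open>G\<close> is available only for \<open>y > 0\<close>;
    continuity at 0, due to \<open>P > 0\<close>, extends monotonicity to the closed half
    line.\<close>
  have mono: "G a \<le> G b" if "0 \<le> a" "a \<le> b" for a b
  proof (rule DERIV_nonneg_imp_increasing_open[OF that(2)])
    fix x assume "a < x" "x < b"
    then show "\<exists>y. (G has_real_derivative y) (at x) \<and> 0 \<le> y"
      using derG[of x] Fnn[of x] that by (intro exI[of _ "x powr (P - 1) * F x"]) auto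
  next
    show "continuous_on {a..b} G"
      by (rule continuous_on_subset[OF contG[of b]]) (use that in auto)
  qed
  have G0: "G 0 = 0" using P by (simp add: G_def)
  have g0: "g 0 = c 0 / P" unfolding g_def powser_zero by (simp add: d_def)
  have F0: "F 0 = c 0" by (simp add: F_def)
  have c0: "c 0 \<ge> 0" using Fnn[of 0] F0 by simp
  have gnn: "g y \<ge> 0" if "y \<ge> 0" for y
  proof (cases "y = 0")
    case True then show ?thesis using c0 P g0 by simp
  next
    case False
    then have "y powr P * g y \<ge> 0" "y powr P > 0"
      using mono[of 0 y] G0 that by (auto simp: G_def)
    then show ?thesis by (simp add: zero_le_mult_iff)
  qed
  then show "entire_nonneg (\<lambda>n. c n / (P + real n))"
    using sd by (simp add: entire_nonneg_def g_def d_def)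
  assume c0: "c 0 > 0"
  have "g y > 0" if "y \<ge> 0" for y
  proof (cases "y = 0")
    case True then show ?thesis using c0 P g0 by simp
  next
    case False
    with that have y: "y > 0" by simp
    \<comment> \<open>Near 0 the continuous \<open>F\<close> stays positive since
      \<open>F 0 = c 0\<close>; \<open>G\<close> thus grows strictly on \<open>[0, z]\<close>, and
      monotonicity carries the gain on to \<open>y\<close>.\<close>
    have "eventually (\<lambda>t. F t > 0) (at 0)"
      using order_tendstoD(1)[OF contF[of 0, unfolded isCont_def], of 0] F0 c0 by simp
    then obtain e where e: "e > 0" "\<And>t. t \<noteq> 0 \<Longrightarrow> dist t 0 < e \<Longrightarrow> F t > 0"
      unfolding eventually_at by blast
    define z where "z = min y (e / 2)"
    have z: "z > 0" "z \<le> y" "z < e" using y e by (auto simp: z_def)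
    have "G 0 < G z"
    proof (rule DERIV_pos_imp_increasing_open[OF z(1)])
      fix x assume "0 < x" "x < z"
      then show "\<exists>y. (G has_real_derivative y) (at x) \<and> 0 < y"
        using derG[of x] e(2)[of x] z by (intro exI[of _ "x powr (P - 1) * F x"]) auto
    qed (rule contG)
    with mono[of z y] z G0 have "G y > 0" by simp
    then show ?thesis using y by (simp add: G_def zero_less_mult_iff)
  qed
  then show "entire_pos (\<lambda>n. c n / (P + real n))"
    using sd by (simp add: entire_pos_def g_def d_def)
qed

lemma summable_abs_coeff_add:
  fixes c d :: "nat \<Rightarrow> real"
  assumes "\<And>y. summable (\<lambda>n. \<bar>c n\<bar> * y ^ n)" "\<And>y. summable (\<lambda>n. \<bar>d n\<bar> * y ^ n)"
  shows "summable (\<lambda>n. \<bar>c n + d n\<bar> * y ^ n)"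
proof (rule summable_comparison_test')
  show "summable (\<lambda>n. \<bar>c n\<bar> * \<bar>y\<bar> ^ n + \<bar>d n\<bar> * \<bar>y\<bar> ^ n)"
    by (intro summable_add assms)
  fix n
  have "norm (\<bar>c n + d n\<bar> * y ^ n) = \<bar>c n + d n\<bar> * \<bar>y\<bar> ^ n"
    by (simp add: abs_mult power_abs)
  also have "\<dots> \<le> (\<bar>c n\<bar> + \<bar>d n\<bar>) * \<bar>y\<bar> ^ n"
    by (intro mult_right_mono) auto
  finally show "norm (\<bar>c n + d n\<bar> * y ^ n) \<le> \<bar>c n\<bar> * \<bar>y\<bar> ^ n + \<bar>d n\<bar> * \<bar>y\<bar> ^ n"
    by (simp add: algebra_simps)
qed

lemma
  assumes c: "entire_nonneg c" and d: "entire_nonneg d"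
  shows entire_nonneg_add: "entire_nonneg (\<lambda>n. c n + d n)"
    and entire_pos_add: "entire_pos d \<Longrightarrow> entire_pos (\<lambda>n. c n + d n)"
proof -
  have s: "summable (\<lambda>n. \<bar>c n + d n\<bar> * y ^ n)" for y
    using c d by (intro summable_abs_coeff_add) (auto simp: entire_nonneg_def)
  have eq: "(\<Sum>n. (c n + d n) * y ^ n) = (\<Sum>n. c n * y ^ n) + (\<Sum>n. d n * y ^ n)" for y
    using c d by (simp add: suminf_add distrib_right entire_nonneg_summable)
  show "entire_nonneg (\<lambda>n. c n + d n)"
    unfolding entire_nonneg_def eq using s c d by (auto simp: entire_nonneg_def)
  show "entire_pos (\<lambda>n. c n + d n)" if "entire_pos d"
    unfolding entire_pos_def eq using s c that
    by (auto simp: entire_nonneg_def entire_pos_def intro: add_nonneg_pos)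
qed

lemma entire_nonneg_const_mult:
  assumes c: "entire_nonneg c" and k: "k \<ge> 0"
  shows "entire_nonneg (\<lambda>n. k * c n)"
  unfolding entire_nonneg_def
proof (intro conjI allI impI)
  show "summable (\<lambda>n. \<bar>k * c n\<bar> * y ^ n)" for y
    using c by (intro summable_abs_coeff_bounded_mult[where K = "\<bar>k\<bar>"]) (auto simp: entire_nonneg_def)
  fix y :: real assume "y \<ge> 0"
  have "(\<Sum>n. k * c n * y ^ n) = k * (\<Sum>n. c n * y ^ n)"
    using entire_nonneg_summable[OF c, of y] by (simp add: mult.assoc suminf_mult)
  then show "0 \<le> (\<Sum>n. k * c n * y ^ n)"
    using c k \<open>y \<ge> 0\<close> by (simp add: entire_nonneg_def)
qed

section \<open>Weak and strict multipliers\<close>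

text \<open>Monotonicity is recorded because it bounds a multiplier by its value at 0, which gives
  uniform bounds when passing to limits.\<close>

definition pos_multiplier :: "(nat \<Rightarrow> real) \<Rightarrow> bool" where
  "pos_multiplier m \<longleftrightarrow> (\<forall>n. 0 < m n) \<and> decseq m \<and>
     (\<forall>c. entire_nonneg c \<longrightarrow> entire_nonneg (\<lambda>n. m n * c n))"

definition strict_multiplier :: "(nat \<Rightarrow> real) \<Rightarrow> bool" where
  "strict_multiplier m \<longleftrightarrow> pos_multiplier m \<and>
     (\<forall>c. entire_nonneg c \<longrightarrow> c 0 > 0 \<longrightarrow> entire_pos (\<lambda>n. m n * c n))"

lemma pos_multiplier_const: "k > 0 \<Longrightarrow> pos_multiplier (\<lambda>n. k)"
  by (auto simp: pos_multiplier_def decseq_def intro: entire_nonneg_const_mult)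

lemma decseq_mult_nonneg:
  fixes f g :: "nat \<Rightarrow> real"
  assumes "decseq f" "decseq g" "\<And>n. 0 \<le> f n" "\<And>n. 0 \<le> g n"
  shows "decseq (\<lambda>n. f n * g n)"
  using assms unfolding decseq_def by (auto intro!: mult_mono)

lemma pos_multiplier_mult:
  assumes "pos_multiplier m" "pos_multiplier m'"
  shows "pos_multiplier (\<lambda>n. m n * m' n)"
  unfolding pos_multiplier_def
proof (intro conjI allI impI)
  show "decseq (\<lambda>n. m n * m' n)"
    using assms by (intro decseq_mult_nonneg) (auto simp: pos_multiplier_def less_imp_le)
  show "0 < m n * m' n" for n using assms by (simp add: pos_multiplier_def)
  fix c assume "entire_nonneg c"
  then have "entire_nonneg (\<lambda>n. m n * (m' n * c n))"
    using assms by (simp add: pos_multiplier_def)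
  then show "entire_nonneg (\<lambda>n. m n * m' n * c n)" by (simp add: mult.assoc)
qed

text \<open>Positivity of \<open>m'\<close> keeps the leading coefficient positive, so one strict
  factor makes the product strict.\<close>

lemma strict_multiplier_mult1:
  assumes "strict_multiplier m" "pos_multiplier m'"
  shows "strict_multiplier (\<lambda>n. m n * m' n)"
  unfolding strict_multiplier_def
proof (intro conjI allI impI)
  show "pos_multiplier (\<lambda>n. m n * m' n)"
    using assms by (auto intro: pos_multiplier_mult simp: strict_multiplier_def)
  fix c :: "nat \<Rightarrow> real" assume c: "entire_nonneg c" "c 0 > 0"
  have "entire_nonneg (\<lambda>n. m' n * c n)" "m' 0 * c 0 > 0"
    using c assms by (auto simp: pos_multiplier_def)
  then have "entire_pos (\<lambda>n. m n * (m' n * c n))"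
    using assms by (simp add: strict_multiplier_def)
  then show "entire_pos (\<lambda>n. m n * m' n * c n)" by (simp add: mult.assoc)
qed

lemma pos_multiplier_prod:
  assumes "\<And>j. j \<in> I \<Longrightarrow> pos_multiplier (m j)"
  shows "pos_multiplier (\<lambda>n. \<Prod>j\<in>I. m j n)"
  using assms
  by (induction I rule: infinite_finite_induct)
     (auto intro: pos_multiplier_const pos_multiplier_mult)

lemma strict_multiplier_inverse_linear:
  assumes "P > 0"
  shows "strict_multiplier (\<lambda>n. 1 / (P + real n))"
  unfolding strict_multiplier_def pos_multiplier_def decseq_def
  using entire_divide_shift[OF _ assms] assms by (auto simp: field_simps add_pos_nonneg)

text \<open>The series of \<open>c\<close> is nonnegative and the one of
  \<open>k * m n * c n\<close> is positive, hence so is their sum.\<close>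

lemma strict_multiplier_one_plus:
  assumes "strict_multiplier m" "k > 0"
  shows "strict_multiplier (\<lambda>n. 1 + k * m n)"
proof -
  have nn: "entire_nonneg (\<lambda>n. k * (m n * c n))" if "entire_nonneg c" for c
    using assms that by (intro entire_nonneg_const_mult) (auto simp: strict_multiplier_def pos_multiplier_def)
  have pos: "entire_pos (\<lambda>n. m n * (k * c n))" if "entire_nonneg c" "c 0 > 0" for c
    using assms that entire_nonneg_const_mult[of c k]
    by (auto simp: strict_multiplier_def)
  \<comment> \<open>Two groupings: the constant stays outside for the weak part and joins
    \<open>c\<close> for the strict part, where strictness of \<open>m\<close> is applied to
    \<open>k * c n\<close>.\<close>
  have dist: "(\<lambda>n. (1 + k * m n) * c n) = (\<lambda>n. c n + k * (m n * c n))" 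
       "(\<lambda>n. (1 + k * m n) * c n) = (\<lambda>n. c n + m n * (k * c n))" for c
    by (simp_all add: algebra_simps)
  show ?thesis
    unfolding strict_multiplier_def pos_multiplier_def
  proof (intro conjI allI impI)
    show "0 < 1 + k * m n" for n
      using assms by (auto simp: strict_multiplier_def pos_multiplier_def intro!: add_pos_pos)
    show "decseq (\<lambda>n. 1 + k * m n)"
      using assms by (auto simp: strict_multiplier_def pos_multiplier_def decseq_def)
    show "entire_nonneg (\<lambda>n. (1 + k * m n) * c n)" if "entire_nonneg c" for c
      unfolding dist(1) by (intro entire_nonneg_add that nn)
    show "entire_pos (\<lambda>n. (1 + k * m n) * c n)" if "entire_nonneg c" "c 0 > 0" for c
      unfolding dist(2) by (intro entire_pos_add that pos entire_pos_imp_nonneg)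
  qed
qed

text \<open>The quotient is \<open>1 + (q - p) / (p + n)\<close>. The larger parameter is in the
  numerator because Gamma functions are limits of reciprocals of such products.\<close>

lemma strict_multiplier_shift_quotient:
  assumes "0 < p" "p < q"
  shows "strict_multiplier (\<lambda>n. (q + real n) / (p + real n))"
proof -
  have "strict_multiplier (\<lambda>n. 1 + (q - p) * (1 / (p + real n)))"
    using assms by (intro strict_multiplier_one_plus strict_multiplier_inverse_linear) auto
  moreover have "1 + (q - p) * (1 / (p + real n)) = (q + real n) / (p + real n)" for n
    using assms by (simp add: field_simps add_pos_nonneg)
  ultimately show ?thesis by simp
qed

text \<open>Equal sums make numerator and denominator differ only by the constant
  \<open>q1 * q2 - p1 * p2 = (q1 - p1) * (q2 - p1) > 0\<close>, so the quotient is 1 plus a positive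
  multiple of a product of two strict multipliers.\<close>

lemma strict_multiplier_pair_quotient:
  assumes "0 < p1" "p1 < q1" "p1 < q2" "p1 + p2 = q1 + q2"
  shows "strict_multiplier (\<lambda>n. (q1 + real n) * (q2 + real n) / ((p1 + real n) * (p2 + real n)))"
proof -
  have p2: "p2 > 0" "p2 = q1 + q2 - p1" using assms by auto
  have k: "q1 * q2 - p1 * p2 = (q1 - p1) * (q2 - p1)" by (simp add: p2 algebra_simps)
  have "strict_multiplier (\<lambda>n. 1 / (p1 + real n) * (1 / (p2 + real n)))"
    using assms p2 by (intro strict_multiplier_mult1 strict_multiplier_inverse_linear)
      (auto intro: strict_multiplier_inverse_linear[unfolded strict_multiplier_def, THEN conjunct1])
  then have "strict_multiplier (\<lambda>n. 1 + (q1 * q2 - p1 * p2) * (1 / (p1 + real n) * (1 / (p2 + real n))))"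
    using assms by (intro strict_multiplier_one_plus) (auto simp: k)
  moreover have "1 + (q1 * q2 - p1 * p2) * (1 / (p1 + real n) * (1 / (p2 + real n)))
      = (q1 + real n) * (q2 + real n) / ((p1 + real n) * (p2 + real n))" for n
  proof -
    have "p1 + real n > 0" "p2 + real n > 0" using assms p2 by (auto intro: add_pos_nonneg)
    then have "1 + (q1 * q2 - p1 * p2) * (1 / (p1 + real n) * (1 / (p2 + real n)))
      = ((p1 + real n) * (p2 + real n) + (q1 * q2 - p1 * p2)) / ((p1 + real n) * (p2 + real n))"
      by (simp add: add_divide_distrib)
    also have "(p1 + real n) * (p2 + real n) + (q1 * q2 - p1 * p2) = (q1 + real n) * (q2 + real n)"
      by (simp add: p2 algebra_simps)
    finally show ?thesis .
  qed
  ultimately show ?thesis by simp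
qed

text \<open>Tannery's theorem interchanges the limit with the power series.\<close>

lemma pos_multiplier_limit:
  assumes m: "\<And>j. pos_multiplier (m j)"
    and lim: "\<And>n. (\<lambda>j. m j n) \<longlonglongrightarrow> M n" and M: "\<And>n. 0 < M n"
  shows "pos_multiplier M"
  unfolding pos_multiplier_def
proof (intro conjI allI impI)
  show "0 < M n" for n by (rule M)
  have dec: "m j n' \<le> m j n" if "n \<le> n'" for j n n'
    using m that by (auto simp: pos_multiplier_def decseq_def)
  show decM: "decseq M"
    unfolding decseq_def by (intro allI impI) (rule LIMSEQ_le[OF lim lim], use dec in auto)
  \<comment> \<open>The convergent sequence \<open>m j 0\<close> is bounded in \<open>j\<close>; as
    every \<open>m j\<close> is positive and decreasing, \<open>K\<close> bounds all values at once
    and yields the summable majorant.\<close>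
  obtain K where K: "\<And>j. \<bar>m j 0\<bar> \<le> K"
    using convergent_imp_Bseq[OF convergentI[OF lim[of 0]]] unfolding Bseq_def by auto
  have mb: "\<bar>m j n\<bar> \<le> K" for j n
    using dec[of 0 n j] K[of j] m[of j] less_imp_le[of 0 "m j n"] by (auto simp: pos_multiplier_def)
  have Mb: "\<bar>M n\<bar> \<le> K" for n
    by (rule LIMSEQ_le_const2[OF tendsto_rabs[OF lim]]) (use mb in auto)
  fix c assume c: "entire_nonneg c"
  have sc: "summable (\<lambda>n. \<bar>c n\<bar> * y ^ n)" for y
    using c by (simp add: entire_nonneg_def)
  show "entire_nonneg (\<lambda>n. M n * c n)"
    unfolding entire_nonneg_def
  proof (intro conjI allI impI)
    show "summable (\<lambda>n. \<bar>M n * c n\<bar> * y ^ n)" for y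
      by (rule summable_abs_coeff_bounded_mult[OF sc Mb])
    fix y :: real assume y: "y \<ge> 0"
    have "(\<lambda>j. \<Sum>n. m j n * c n * y ^ n) \<longlonglongrightarrow> (\<Sum>n. M n * c n * y ^ n)"
    proof (rule tannerys_theorem[where M = "\<lambda>n. K * (\<bar>c n\<bar> * y ^ n)", THEN conjunct2, THEN conjunct2])
      show "(\<lambda>j. m j n * c n * y ^ n) \<longlonglongrightarrow> M n * c n * y ^ n" for n
        by (intro tendsto_intros lim)
      show "\<forall>\<^sub>F (n, j) in at_top \<times>\<^sub>F sequentially. norm (m j n * c n * y ^ n) \<le> K * (\<bar>c n\<bar> * y ^ n)"
        using mb y by (intro always_eventually) (auto simp: abs_mult mult.assoc intro!: mult_right_mono)
      show "summable (\<lambda>n. K * (\<bar>c n\<bar> * y ^ n))" by (intro summable_mult sc)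
    qed auto
    moreover have "0 \<le> (\<Sum>n. m j n * c n * y ^ n)" for j
      using m[of j] c y by (simp add: pos_multiplier_def entire_nonneg_def)
    ultimately show "0 \<le> (\<Sum>n. M n * c n * y ^ n)"
      by (meson LIMSEQ_le_const)
  qed
qed

text \<open>A limit of strict multipliers need not be strict; strictness comes from the factor \<open>j = 0\<close>,
  which is split off before passing to the limit.\<close>

lemma strict_multiplier_limit_prod:
  assumes f: "\<And>j. strict_multiplier (\<lambda>n. f (n + j))"
    and s: "\<And>j. s j > 0"
    and G: "\<And>n. G n > 0"
    and lim: "\<And>n. (\<lambda>J. s J * (\<Prod>j\<le>J. f (n + j))) \<longlonglongrightarrow> G n"
  shows "strict_multiplier G"
proof -
  have fpos: "f n > 0" for n
    using f[of 0] by (simp add: strict_multiplier_def pos_multiplier_def)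
  have "pos_multiplier (\<lambda>n. G n / f n)"
  proof (rule pos_multiplier_limit)
    show "pos_multiplier (\<lambda>n. s J * (\<Prod>j\<in>{1..J}. f (n + j)))" for J
      using f s by (intro pos_multiplier_mult pos_multiplier_prod pos_multiplier_const)
        (auto simp: strict_multiplier_def)
    show "(\<lambda>J. s J * (\<Prod>j\<in>{1..J}. f (n + j))) \<longlonglongrightarrow> G n / f n" for n
    proof -
      have "(\<lambda>J. s J * (\<Prod>j\<le>J. f (n + j)) / f n) \<longlonglongrightarrow> G n / f n"
        using fpos[of n] by (intro tendsto_intros lim) auto
      moreover have "(\<Prod>j\<le>J. f (n + j)) = f n * (\<Prod>j\<in>{1..J}. f (n + j))" for J
        by (simp add: atMost_atLeast0 prod.atLeast_Suc_atMost)
      ultimately show ?thesis using fpos[of n] by (simp add: field_simps)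
    qed
    show "0 < G n / f n" for n using G fpos by simp
  qed
  then have "strict_multiplier (\<lambda>n. f (n + 0) * (G n / f n))"
    by (intro strict_multiplier_mult1 f)
  moreover have "f (n + 0) * (G n / f n) = G n" for n using fpos[of n] by simp
  ultimately show ?thesis by simp
qed

section \<open>Quotients of Gamma functions as multipliers\<close>

lemma Gamma_shift_limit:
  assumes "p > (0::real)"
  shows "(\<lambda>J. fact J * exp ((p + real n) * ln (real J)) / (\<Prod>j\<le>J. p + real (n + j)))
           \<longlonglongrightarrow> Gamma (p + real n)"
  using Gamma_series_LIMSEQ[of "p + real n"]
  unfolding Gamma_series_def pochhammer_prod
  by (simp add: atLeast0LessThan lessThan_Suc_atMost algebra_simps)

text \<open>In the quotient of two Gauss limit formulas the factorials cancel, and the powers of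
  \<open>J\<close> leave a factor independent of \<open>n\<close>, which serves as a scaling
  constant.\<close>

lemma Gamma_quotient_limit:
  assumes "p > 0" "q > (0::real)"
  shows "(\<lambda>J. exp ((p - q) * ln (real J)) * (\<Prod>j\<le>J. (q + real (n + j)) / (p + real (n + j))))
           \<longlonglongrightarrow> Gamma (p + real n) / Gamma (q + real n)"
proof -
  have "Gamma (q + real n) \<noteq> 0" using assms Gamma_real_pos[of "q + real n"] by (smt (verit) of_nat_0_le_iff)
  then have "(\<lambda>J. (fact J * exp ((p + real n) * ln (real J)) / (\<Prod>j\<le>J. p + real (n + j))) /
         (fact J * exp ((q + real n) * ln (real J)) / (\<Prod>j\<le>J. q + real (n + j))))
           \<longlonglongrightarrow> Gamma (p + real n) / Gamma (q + real n)"
    by (intro tendsto_divide Gamma_shift_limit assms)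
  moreover have "(fact J * exp ((p + real n) * ln (real J)) / P) /
         (fact J * exp ((q + real n) * ln (real J)) / Q) = exp ((p - q) * ln (real J)) * (Q / P)"
    for J :: nat and P Q :: real
  proof -
    have "exp ((p + real n) * ln (real J)) = exp ((p - q) * ln (real J)) * exp ((q + real n) * ln (real J))"
      by (simp add: exp_add[symmetric] algebra_simps)
    then show ?thesis by simp
  qed
  ultimately show ?thesis by (simp add: prod_dividef)
qed

lemma strict_multiplier_Gamma_quotient:
  assumes "0 < p" "p < q"
  shows "strict_multiplier (\<lambda>n. Gamma (p + real n) / Gamma (q + real n))"
proof (rule strict_multiplier_limit_prod)
  show "strict_multiplier (\<lambda>n. (\<lambda>k. (q + real k) / (p + real k)) (n + j))" for j
    using strict_multiplier_shift_quotient[of "p + real j" "q + real j"] assms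
    by (simp add: ac_simps)
  show "(\<lambda>J. exp ((p - q) * ln (real J)) * (\<Prod>j\<le>J. (\<lambda>k. (q + real k) / (p + real k)) (n + j)))
           \<longlonglongrightarrow> Gamma (p + real n) / Gamma (q + real n)" for n
    using Gamma_quotient_limit[of p q n] assms by simp
qed (use assms in \<open>auto intro!: divide_pos_pos Gamma_real_pos add_pos_nonneg\<close>)

text \<open>By \<open>p1 + p2 = q1 + q2\<close> the powers of \<open>J\<close> in the two limit
  formulas cancel, so the infinite product converges with scaling constant 1.\<close>

lemma strict_multiplier_Gamma_pair_quotient:
  assumes "0 < p1" "p1 < q1" "p1 < q2" "p1 + p2 = q1 + q2"
  shows "strict_multiplier (\<lambda>n. Gamma (p1 + real n) * Gamma (p2 + real n) /
                                (Gamma (q1 + real n) * Gamma (q2 + real n)))"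
proof (rule strict_multiplier_limit_prod)
  let ?f = "\<lambda>k. (q1 + real k) * (q2 + real k) / ((p1 + real k) * (p2 + real k))"
  have pos: "p2 > 0" "q1 > 0" "q2 > 0" using assms by auto
  show "strict_multiplier (\<lambda>n. ?f (n + j))" for j
    using strict_multiplier_pair_quotient[of "p1 + real j" "q1 + real j" "q2 + real j" "p2 + real j"] assms
    by (simp add: ac_simps)
  show "(\<lambda>J. 1 * (\<Prod>j\<le>J. ?f (n + j)))
           \<longlonglongrightarrow> Gamma (p1 + real n) * Gamma (p2 + real n) /
                (Gamma (q1 + real n) * Gamma (q2 + real n))" for n
  proof -
    have s: "p1 - q1 = - (p2 - q2)" using assms by simp
    have "(\<lambda>J. (exp ((p1 - q1) * ln (real J)) * (\<Prod>j\<le>J. (q1 + real (n + j)) / (p1 + real (n + j)))) *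
               (exp ((p2 - q2) * ln (real J)) * (\<Prod>j\<le>J. (q2 + real (n + j)) / (p2 + real (n + j)))))
           \<longlonglongrightarrow> (Gamma (p1 + real n) / Gamma (q1 + real n)) * (Gamma (p2 + real n) / Gamma (q2 + real n))"
      using assms pos by (intro tendsto_mult Gamma_quotient_limit) auto
    moreover have "(exp ((p1 - q1) * ln (real J)) * (\<Prod>j\<le>J. (q1 + real (n + j)) / (p1 + real (n + j)))) *
               (exp ((p2 - q2) * ln (real J)) * (\<Prod>j\<le>J. (q2 + real (n + j)) / (p2 + real (n + j))))
        = (\<Prod>j\<le>J. ?f (n + j))" for J
    proof -
      have "exp ((p1 - q1) * ln (real J)) * exp ((p2 - q2) * ln (real J)) = 1"
        unfolding s exp_add[symmetric] distrib_right[symmetric] by simp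
      then have "(exp ((p1 - q1) * ln (real J)) * X) * (exp ((p2 - q2) * ln (real J)) * Y) = X * Y" for X Y
        by (metis (no_types, lifting) mult.assoc mult.left_commute mult_1)
      then show ?thesis by (simp only: prod.distrib[symmetric] times_divide_times_eq)
    qed
    ultimately show ?thesis by simp
  qed
qed (use assms in \<open>auto intro!: divide_pos_pos mult_pos_pos Gamma_real_pos add_pos_nonneg\<close>)

section \<open>Gamma quotients and weak majorization\<close>

text \<open>Multisets are used since the value does not depend on the order of the parameters and a
  common parameter cancels wherever it stands.\<close>

definition Gamma_ratio :: "real multiset \<Rightarrow> real multiset \<Rightarrow> nat \<Rightarrow> real" where
  "Gamma_ratio P Q n = (\<Prod>p\<in>#P. Gamma (p + real n)) / (\<Prod>q\<in>#Q. Gamma (q + real n))"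

lemma Gamma_shift_pos: "0 < p \<Longrightarrow> 0 < Gamma (p + real n)"
  by (intro Gamma_real_pos add_pos_nonneg) auto

lemma pos_multiplier_Gamma_ratio_self:
  assumes "\<And>p. p \<in># P \<Longrightarrow> 0 < p"
  shows "pos_multiplier (Gamma_ratio P P)"
proof -
  have "(\<Prod>p\<in>#P. Gamma (p + real n)) \<noteq> 0" for n
    using assms by (induction P) (auto simp: less_imp_neq[OF Gamma_shift_pos, symmetric])
  then have "Gamma_ratio P P = (\<lambda>n. 1)"
    by (auto simp: Gamma_ratio_def)
  then show ?thesis using pos_multiplier_const[of 1] by simp
qed

lemma sum_list_take_le_const:
  fixes xs :: "real list"
  assumes "\<And>x. x \<in> set xs \<Longrightarrow> x \<le> q" "k \<le> length xs"
  shows "sum_list (take k xs) \<le> real k * q"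
proof -
  have "sum_list (take k xs) = sum_list (map (\<lambda>x. x) (take k xs))" by simp
  also have "\<dots> \<le> sum_list (map (\<lambda>x. q) (take k xs))"
    by (rule sum_list_mono) (meson assms(1) in_set_takeD)
  also have "\<dots> = real k * q" using assms(2) by (simp add: sum_list_triv)
  finally show ?thesis .
qed

lemma sum_list_take_ge_const:
  fixes xs :: "real list"
  assumes "\<And>x. x \<in> set xs \<Longrightarrow> q \<le> x" "k \<le> length xs"
  shows "real k * q \<le> sum_list (take k xs)"
proof -
  have "real k * q = sum_list (map (\<lambda>x. q) (take k xs))" using assms(2) by (simp add: sum_list_triv)
  also have "\<dots> \<le> sum_list (map (\<lambda>x. x) (take k xs))"
    by (rule sum_list_mono) (meson assms(1) in_set_takeD)
  finally show ?thesis by simp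
qed

text \<open>Induction removes the smallest entry \<open>q\<close> of \<open>qs\<close>. Either no
  entry of \<open>ps\<close> exceeds \<open>q\<close>, and the smallest one is paired with
  \<open>q\<close>; or two neighbours in \<open>ps\<close> around \<open>q\<close> are moved
  together until one equals \<open>q\<close>. One nontrivial move makes the result strict.\<close>

lemma strict_multiplier_Gamma_ratio:
  assumes "sorted ps" "sorted qs" "length ps = length qs" "\<And>p. p \<in> set ps \<Longrightarrow> 0 < p"
    and "\<And>k. k \<le> length ps \<Longrightarrow> sum_list (take k ps) \<le> sum_list (take k qs)"
  shows "mset ps = mset qs \<or> strict_multiplier (Gamma_ratio (mset ps) (mset qs))"
  using assms
proof (induction qs arbitrary: ps)
  case Nil
  then show ?case by simp
next
  case (Cons q qs)
  have qs: "sorted qs" "\<And>x. x \<in> set qs \<Longrightarrow> q \<le> x" using Cons.prems(2) by auto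
  \<comment> \<open>Either outcome of the induction hypothesis gives a weak multiplier, which is
    enough for the cofactor of a strict one.\<close>
  have weak: "pos_multiplier (Gamma_ratio (mset rs) (mset qs))"
    if "mset rs = mset qs \<or> strict_multiplier (Gamma_ratio (mset rs) (mset qs))"
       "\<And>p. p \<in> set rs \<Longrightarrow> 0 < p" for rs
    using that pos_multiplier_Gamma_ratio_self[of "mset rs"] by (auto simp: strict_multiplier_def)
  obtain p0 ps0 where ps0: "ps = p0 # ps0" using Cons.prems(3) by (cases ps) auto
  have p0: "p0 \<le> q" using Cons.prems(5)[of 1] by (simp add: ps0)
  then have q: "q > 0" using Cons.prems(4)[of p0] ps0 by simp
  show ?case
  proof (cases "\<forall>x\<in>set ps. x \<le> q")
    case True
    have len: "length ps0 = length qs" using Cons.prems(3) ps0 by simp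
    have IH: "mset ps0 = mset qs \<or> strict_multiplier (Gamma_ratio (mset ps0) (mset qs))"
    proof (rule Cons.IH)
      \<comment> \<open>The entries of \<open>ps0\<close> are at most \<open>q\<close> and those of
        \<open>qs\<close> at least \<open>q\<close>, so \<open>real k * q\<close> separates the
        prefix sums.\<close>
      fix k assume k: "k \<le> length ps0"
      have "sum_list (take k ps0) \<le> real k * q"
        using True k by (intro sum_list_take_le_const) (auto simp: ps0)
      also have "\<dots> \<le> sum_list (take k qs)"
        using qs k len by (intro sum_list_take_ge_const) auto
      finally show "sum_list (take k ps0) \<le> sum_list (take k qs)" .
    qed (use Cons.prems ps0 len in auto)
    have eq: "Gamma_ratio (mset ps) (mset (q # qs)) =
               (\<lambda>n. Gamma (p0 + real n) / Gamma (q + real n) * Gamma_ratio (mset ps0) (mset qs) n)"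
      by (simp add: Gamma_ratio_def ps0 fun_eq_iff)
    show ?thesis
    proof (cases "p0 = q")
      case True
      have "Gamma (q + real n) \<noteq> 0" for n using Gamma_shift_pos[OF q, of n] by simp
      with True have "Gamma_ratio (mset ps) (mset (q # qs)) = Gamma_ratio (mset ps0) (mset qs)"
        unfolding eq by simp
      with IH True ps0 show ?thesis by auto
    next
      case False
      with p0 have "p0 < q" by simp
      then have "strict_multiplier (Gamma_ratio (mset ps) (mset (q # qs)))"
        unfolding eq using Cons.prems(4) ps0 IH
        by (intro strict_multiplier_mult1 strict_multiplier_Gamma_quotient weak) auto
      then show ?thesis ..
    qed
  next
    case False
    \<comment> \<open>With \<open>c\<close> the last entry of \<open>ps\<close> that is at most \<open>q\<close> and \<open>d\<close> the next one,
      replacing \<open>c, d\<close> by \<open>q, c + d - q\<close> keeps the majorization and allows cancelling \<open>q\<close>.\<close>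
    define l where "l = takeWhile (\<lambda>x. x \<le> q) ps"
    define r where "r = dropWhile (\<lambda>x. x \<le> q) ps"
    have lr: "ps = l @ r" by (simp add: l_def r_def)
    have l: "l \<noteq> []" using p0 by (simp add: l_def ps0)
    have r: "r \<noteq> []" using False by (auto simp: r_def)
    define us where "us = butlast l"
    define c where "c = last l"
    have l_eq: "l = us @ [c]" using l by (simp add: us_def c_def)
    obtain d ws where r_eq: "r = d # ws" using r by (cases r) auto
    have ps: "ps = us @ c # d # ws" by (simp add: lr l_eq r_eq)
    have cq: "c \<le> q" "\<And>x. x \<in> set us \<Longrightarrow> x \<le> q"
      using set_takeWhileD[of _ "\<lambda>x. x \<le> q" ps] l_eq unfolding l_def[symmetric] by auto
    have dq: "q < d"
      using hd_dropWhile[of "\<lambda>x. x \<le> q" ps] r unfolding r_def[symmetric] r_eq by simp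
    have c0: "c > 0" "d > 0" using Cons.prems(4) ps by auto
    define d' where "d' = c + d - q"
    have d': "c \<le> d'" "d' \<le> d" "c + d = q + d'" using cq dq by (auto simp: d'_def)
    define rs where "rs = us @ d' # ws"
    have len: "length rs = length qs" using Cons.prems(3) by (simp add: ps rs_def)
    have IH: "mset rs = mset qs \<or> strict_multiplier (Gamma_ratio (mset rs) (mset qs))"
    proof (rule Cons.IH)
      show "sorted rs" using Cons.prems(1) d' unfolding ps rs_def
        by (auto simp: sorted_append)
      show "0 < p" if "p \<in> set rs" for p
        using that Cons.prems(4) less_le_trans[OF c0(1) d'(1)] by (auto simp: rs_def ps)
      fix k assume k: "k \<le> length rs"
      show "sum_list (take k rs) \<le> sum_list (take k qs)"
      proof (cases "k \<le> length us")
        case True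
        then have "sum_list (take k rs) = sum_list (take k us)" by (simp add: rs_def)
        also have "\<dots> \<le> real k * q" using True cq by (intro sum_list_take_le_const) auto
        also have "\<dots> \<le> sum_list (take k qs)"
          using qs k len by (intro sum_list_take_ge_const) auto
        finally show ?thesis .
      next
        case False
        then obtain i where i: "k = length us + Suc i" by (metis add_Suc_right less_iff_Suc_add not_le)
        \<comment> \<open>A prefix containing \<open>d'\<close>, together with \<open>q\<close>, has
          the same sum as the prefix of \<open>ps\<close> one entry longer, which contains both
          \<open>c\<close> and \<open>d\<close>.\<close>
        have "sum_list (take k rs) + q = sum_list (take (Suc k) ps)"
          using d' by (simp add: i rs_def ps)
        also have "\<dots> \<le> sum_list (take (Suc k) (q # qs))"
          using k by (intro Cons.prems(5)) (simp add: rs_def ps)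
        finally show ?thesis by simp
      qed
    qed (use qs len in auto)
    have "Gamma (d' + real n) \<noteq> 0" for n
      using Gamma_shift_pos[OF less_le_trans[OF c0(1) d'(1)], of n] by simp
    then have eq: "Gamma_ratio (mset ps) (mset (q # qs)) =
               (\<lambda>n. Gamma (c + real n) * Gamma (d + real n) / (Gamma (q + real n) * Gamma (d' + real n))
                      * Gamma_ratio (mset rs) (mset qs) n)"
      by (auto simp: Gamma_ratio_def rs_def ps fun_eq_iff)
    show ?thesis
    \<comment> \<open>For \<open>c = q\<close> the move is void and only a common factor cancels, so
      both alternatives of the induction hypothesis carry over.\<close>
    proof (cases "c = q")
      case True
      then have "d' = d" by (simp add: d'_def)
      moreover have "Gamma (d + real n) \<noteq> 0" "Gamma (q + real n) \<noteq> 0" for n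
        using Gamma_shift_pos[of _ n] q c0 by (auto simp: less_imp_neq[symmetric])
      ultimately have "Gamma_ratio (mset ps) (mset (q # qs)) = Gamma_ratio (mset rs) (mset qs)"
        unfolding eq using True by simp
      with IH True \<open>d' = d\<close> show ?thesis by (auto simp: ps rs_def)
    next
      case False
      then have "strict_multiplier (\<lambda>n. Gamma (c + real n) * Gamma (d + real n) /
                    (Gamma (q + real n) * Gamma (d' + real n)))"
        using c0 cq dq by (intro strict_multiplier_Gamma_pair_quotient) (auto simp: d'_def)
      moreover have "pos_multiplier (Gamma_ratio (mset rs) (mset qs))"
        using Cons.prems(4) less_le_trans[OF c0(1) d'(1)] by (intro weak IH) (auto simp: rs_def ps)
      ultimately have "strict_multiplier (Gamma_ratio (mset ps) (mset (q # qs)))"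
        unfolding eq by (rule strict_multiplier_mult1)
      then show ?thesis ..
    qed
  qed
qed

section \<open>The series of \<open>J\<^bsub>\<nu>\<^esub>\<^sup>2\<close>\<close>

lemma pos_notin_nonpos_Ints: "(x::real) > 0 \<Longrightarrow> x \<notin> \<int>\<^sub>\<le>\<^sub>0"
  using nonpos_Ints_nonpos[of x] by auto

lemma Gamma_duplication_real:
  assumes "z > (0::real)"
  shows "Gamma z * Gamma (z + 1/2) = 2 powr (1 - 2 * z) * sqrt pi * Gamma (2 * z)"
proof -
  have nn: "complex_of_real z \<notin> \<int>\<^sub>\<le>\<^sub>0" "complex_of_real z + 1/2 \<notin> \<int>\<^sub>\<le>\<^sub>0"
    using assms by (auto elim!: nonpos_Ints_cases simp: complex_eq_iff)
  have "complex_of_real (Gamma z * Gamma (z + 1/2)) = Gamma (complex_of_real z) * Gamma (complex_of_real z + 1/2)"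
    by (simp add: Gamma_complex_of_real[symmetric])
  also have "\<dots> = exp ((1 - 2 * complex_of_real z) * of_real (ln 2)) * of_real (sqrt pi) * Gamma (2 * complex_of_real z)"
    by (rule Gamma_legendre_duplication[OF nn])
  also have "\<dots> = complex_of_real (2 powr (1 - 2 * z) * sqrt pi * Gamma (2 * z))"
    by (simp add: Gamma_complex_of_real[symmetric] powr_def exp_of_real[symmetric])
  finally show ?thesis by (simp only: of_real_eq_iff)
qed

text \<open>Duplication at \<open>a / 2 + n\<close> turns a Gamma factor advancing by 2 into two
  factors advancing by 1; the dependence of the power of 2 on \<open>n\<close> is
  \<open>4 ^ n\<close>.\<close>

lemma Gamma_shift_even:
  assumes "a > (0::real)"
  shows "Gamma (a + 2 * real n) =
           2 powr (a - 1) / sqrt pi * 4 ^ n * Gamma (a / 2 + real n) * Gamma ((a + 1) / 2 + real n)"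
proof -
  have "Gamma (a / 2 + real n) * Gamma ((a + 1) / 2 + real n)
      = 2 powr (1 - a - 2 * real n) * sqrt pi * Gamma (a + 2 * real n)"
  proof -
    have z: "2 * (a / 2 + real n) = a + 2 * real n" "a / 2 + real n + 1 / 2 = (a + 1) / 2 + real n"
      "1 - (a + 2 * real n) = 1 - a - 2 * real n"
      by (simp_all add: field_simps)
    have "a / 2 + real n > 0" using assms by (simp add: add_pos_nonneg)
    from Gamma_duplication_real[OF this] show ?thesis unfolding z .
  qed
  also have "2 powr (1 - a - 2 * real n) = inverse (2 powr (a - 1) * 4 ^ n)"
  proof -
    have "(4::real) ^ n = 2 powr (2 * real n)" by (simp add: powr_powr[symmetric] powr_realpow)
    moreover have "1 - a - 2 * real n = - ((a - 1) + 2 * real n)" by simp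
    ultimately show ?thesis by (simp only: powr_minus powr_add)
  qed
  finally show ?thesis by (simp add: field_simps)
qed

lemma summable_bessel_series:
  assumes "\<nu> > (-1::real)"
  shows "summable (\<lambda>n. \<bar>(-1) ^ n / (fact n * Gamma (\<nu> + 1 + real n))\<bar> * y ^ n)"
proof -
  define f where "f = (\<lambda>n. \<bar>(-1) ^ n / (fact n * Gamma (\<nu> + 1 + real n))\<bar> * y ^ n)"
  \<comment> \<open>For \<open>n \<ge> N\<close> the number \<open>N * (\<nu> + 1)\<close> bounds
    the denominator of the ratio of consecutive terms from below, so the ratio is at most
    1/2.\<close>
  obtain N where N: "2 * \<bar>y\<bar> / (\<nu> + 1) < real N" using reals_Archimedean2 by blast
  have "summable f"
  proof (rule summable_ratio_test[of "1/2" N])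
    fix n assume n: "n \<ge> N"
    have G: "Gamma (\<nu> + 1 + real n) > 0" using assms by (intro Gamma_shift_pos) auto
    have g: "Gamma (\<nu> + 1 + real (Suc n)) = (\<nu> + 1 + real n) * Gamma (\<nu> + 1 + real n)"
      using Gamma_plus1[OF pos_notin_nonpos_Ints, of "\<nu> + 1 + real n"] assms
      by (simp add: add_ac)
    have pos: "\<nu> + 1 + real n > 0" using assms by auto
    have eq: "norm (f (Suc n)) = \<bar>y\<bar> / (real (Suc n) * (\<nu> + 1 + real n)) * norm (f n)"
      using G pos unfolding f_def g by (simp add: abs_mult power_abs divide_simps)
    have "2 * \<bar>y\<bar> < real N * (\<nu> + 1)" using N assms by (simp add: field_simps)
    also have "\<dots> \<le> real (Suc n) * (\<nu> + 1 + real n)" using n assms by (intro mult_mono) auto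
    finally have "\<bar>y\<bar> / (real (Suc n) * (\<nu> + 1 + real n)) \<le> 1/2"
      using pos by (simp add: field_simps)
    then show "norm (f (Suc n)) \<le> 1/2 * norm (f n)"
      unfolding eq by (intro mult_right_mono) auto
  qed simp
  then show ?thesis by (simp add: f_def)
qed

text \<open>Up to the factor \<open>(-1)\<^sup>n / \<Gamma>(\<nu> + 1 + n)\<^sup>2\<close>, this is Vandermonde's identity for
  \<open>2 (\<nu> + n)\<close> over \<open>n\<close>.\<close>

lemma bessel_square_convolution:
  assumes "\<nu> > (-1/2::real)"
  shows "(\<Sum>i\<le>n. ((-1) ^ i / (fact i * Gamma (\<nu> + 1 + real i))) *
                 ((-1) ^ (n - i) / (fact (n - i) * Gamma (\<nu> + 1 + real (n - i)))))
       = (-1) ^ n * Gamma (2 * \<nu> + 1 + 2 * real n) /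
           (fact n * Gamma (2 * \<nu> + 1 + real n) * (Gamma (\<nu> + 1 + real n))\<^sup>2)"
proof -
  define g where "g = Gamma (\<nu> + 1 + real n)"
  have g: "g > 0" unfolding g_def using assms by (intro Gamma_shift_pos) auto
  \<comment> \<open>The pairing is crosswise: \<open>fact i\<close> goes with the Gamma factor of
    index \<open>n - i\<close> and conversely, giving two binomial coefficients with the same upper
    entry.\<close>
  have gb: "(\<nu> + real n gchoose k) = g / (fact k * Gamma (\<nu> + 1 + real (n - k)))" if "k \<le> n" for k
    using gbinomial_Gamma[OF pos_notin_nonpos_Ints, of "\<nu> + real n" k] that assms
    by (simp add: g_def of_nat_diff algebra_simps)
  have "(\<Sum>i\<le>n. ((-1) ^ i / (fact i * Gamma (\<nu> + 1 + real i))) *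
                 ((-1) ^ (n - i) / (fact (n - i) * Gamma (\<nu> + 1 + real (n - i)))))
      = (\<Sum>i\<le>n. (-1) ^ n / g\<^sup>2 * ((\<nu> + real n gchoose i) * (\<nu> + real n gchoose (n - i))))"
  proof (rule sum.cong)
    fix i assume "i \<in> {..n}"
    then have i: "i \<le> n" by simp
    have "(-1::real) ^ i * (-1) ^ (n - i) = (-1) ^ n"
      using i by (simp add: power_add[symmetric])
    then show "((-1) ^ i / (fact i * Gamma (\<nu> + 1 + real i))) *
                 ((-1) ^ (n - i) / (fact (n - i) * Gamma (\<nu> + 1 + real (n - i))))
        = (-1) ^ n / g\<^sup>2 * ((\<nu> + real n gchoose i) * (\<nu> + real n gchoose (n - i)))"
      using g i by (simp add: gb power2_eq_square)
  qed simp
  also have "\<dots> = (-1) ^ n / g\<^sup>2 * (2 * (\<nu> + real n) gchoose n)"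
    unfolding sum_distrib_left[symmetric] atMost_atLeast0 gbinomial_Vandermonde mult_2 ..
  also have "(2 * (\<nu> + real n) gchoose n)
      = Gamma (2 * \<nu> + 1 + 2 * real n) / (fact n * Gamma (2 * \<nu> + 1 + real n))"
    using gbinomial_Gamma[OF pos_notin_nonpos_Ints, of "2 * (\<nu> + real n)" n] assms
    by (simp add: algebra_simps)
  finally show ?thesis by (simp add: g_def)
qed

text \<open>Up to a positive constant the sequence consists of the coefficients of a Cauchy square,
  so its series is a square at every real \<open>y\<close>. At \<open>y = t\<^sup>2\<close> with
  \<open>t > 0\<close> it is a constant times \<open>t powr (-2 * \<nu>)\<close> times the square of
  \<open>bessel_J \<nu> t\<close>.\<close>

lemma entire_nonneg_bessel_square:
  assumes "\<nu> > (-1/2::real)"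
  shows "entire_nonneg (\<lambda>n. (-1) ^ n * Gamma (\<nu> + 1/2 + real n) /
           (fact n * Gamma (\<nu> + 1 + real n) * Gamma (2 * \<nu> + 1 + real n)))"
proof -
  define b where "b = (\<lambda>n. (-1) ^ n / (fact n * Gamma (\<nu> + 1 + real n)))"
  \<comment> \<open>This is the constant of \<open>Gamma_shift_even\<close> at
    \<open>a = 2 * \<nu> + 1\<close>; the accompanying \<open>4 ^ n\<close> is absorbed by taking
    the series of \<open>b\<close> at \<open>y / 4\<close>.\<close>
  define K where "K = 2 powr (2 * \<nu>) / sqrt pi"
  have K: "K > 0" by (simp add: K_def)
  define c where "c = (\<lambda>n. (-1) ^ n * Gamma (\<nu> + 1/2 + real n) /
           (fact n * Gamma (\<nu> + 1 + real n) * Gamma (2 * \<nu> + 1 + real n)))"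
  have sb: "summable (\<lambda>n. \<bar>b n\<bar> * y ^ n)" for y
    unfolding b_def using assms by (intro summable_bessel_series) auto
  have conv: "c n * y ^ n = inverse K * (\<Sum>i\<le>n. (b i * (y / 4) ^ i) * (b (n - i) * (y / 4) ^ (n - i)))" for n y
  proof -
    have g: "Gamma (\<nu> + 1 + real n) > 0" using assms by (intro Gamma_shift_pos) auto
    have "(\<Sum>i\<le>n. (b i * (y / 4) ^ i) * (b (n - i) * (y / 4) ^ (n - i)))
       = (\<Sum>i\<le>n. b i * b (n - i) * (y / 4) ^ n)"
      by (intro sum.cong) (auto simp: mult_ac power_add[symmetric])
    also have "\<dots> = (-1) ^ n * Gamma (2 * \<nu> + 1 + 2 * real n) /
           (fact n * Gamma (2 * \<nu> + 1 + real n) * (Gamma (\<nu> + 1 + real n))\<^sup>2) * (y / 4) ^ n"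
      unfolding sum_distrib_right[symmetric] b_def bessel_square_convolution[OF assms] ..
    also have "Gamma (2 * \<nu> + 1 + 2 * real n)
       = K * 4 ^ n * Gamma (\<nu> + 1/2 + real n) * Gamma (\<nu> + 1 + real n)"
    proof -
      have "(2 * \<nu> + 1) / 2 + real n = \<nu> + 1/2 + real n" "(2 * \<nu> + 1 + 1) / 2 + real n = \<nu> + 1 + real n"
        "2 * \<nu> + 1 - 1 = 2 * \<nu>"
        by (simp_all add: field_simps)
      with Gamma_shift_even[of "2 * \<nu> + 1" n] assms show ?thesis by (simp only: K_def)
    qed
    finally have eq: "(\<Sum>i\<le>n. (b i * (y / 4) ^ i) * (b (n - i) * (y / 4) ^ (n - i)))
       = (-1) ^ n * (K * 4 ^ n * Gamma (\<nu> + 1/2 + real n) * Gamma (\<nu> + 1 + real n)) /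
           (fact n * Gamma (2 * \<nu> + 1 + real n) * (Gamma (\<nu> + 1 + real n))\<^sup>2) * (y / 4) ^ n" .
    have cancel: "s * G / (F * g * H) * Y = inverse K * (s * (K * p * G * g) / (F * H * g\<^sup>2) * (Y / p))"
      if "p \<noteq> 0" "g \<noteq> 0" for s G F g H Y p :: real
      using that K by (cases "F = 0 \<or> H = 0") (auto simp: power2_eq_square divide_simps)
    show ?thesis unfolding eq unfolding c_def power_divide using g by (intro cancel) auto
  qed
  have "entire_nonneg c"
    unfolding entire_nonneg_def
  proof (intro conjI allI impI)
    have nb: "summable (\<lambda>n. norm (b n * (y / 4) ^ n))" for y
      using sb[of "\<bar>y / 4\<bar>"] by (simp add: abs_mult power_abs)
    show "summable (\<lambda>n. \<bar>c n\<bar> * y ^ n)" for y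
    proof (rule summable_comparison_test')
      show "summable (\<lambda>n. inverse K * (\<Sum>i\<le>n. norm (b i * (y / 4) ^ i) * norm (b (n - i) * (y / 4) ^ (n - i))))"
        using nb by (intro summable_mult summable_Cauchy_product) auto
      fix n
      have "norm (\<bar>c n\<bar> * y ^ n) = \<bar>c n * y ^ n\<bar>" by (simp add: abs_mult)
      also have "\<dots> = inverse K * \<bar>\<Sum>i\<le>n. (b i * (y / 4) ^ i) * (b (n - i) * (y / 4) ^ (n - i))\<bar>"
        unfolding conv using K by (simp add: abs_mult)
      also have "\<dots> \<le> inverse K * (\<Sum>i\<le>n. norm (b i * (y / 4) ^ i) * norm (b (n - i) * (y / 4) ^ (n - i)))"
        using K by (intro mult_left_mono order.trans[OF sum_abs]) (auto simp: abs_mult)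
      finally show "norm (\<bar>c n\<bar> * y ^ n) \<le> \<dots>" .
    qed
    fix y :: real
    have "(\<Sum>n. c n * y ^ n) = inverse K * ((\<Sum>n. b n * (y / 4) ^ n) * (\<Sum>n. b n * (y / 4) ^ n))"
      unfolding conv Cauchy_product[OF nb nb]
      using nb by (intro suminf_mult summable_Cauchy_product) auto
    then show "0 \<le> (\<Sum>n. c n * y ^ n)" using K by simp
  qed
  then show ?thesis by (simp add: c_def)
qed

section \<open>The Bessel integrals\<close>

text \<open>Substitution \<open>t = x * s\<close> in the Beta integral over the unit interval; the
  Bochner form provides integrability and value together.\<close>

lemma has_bochner_integral_Beta_scaled:
  assumes a: "a > 0" and b: "b > 0" and x: "x > (0::real)"
  shows "has_bochner_integral lborel (\<lambda>t. indicator {0..x} t * ((x - t) powr (b - 1) * t powr (a - 1)))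
           (x powr (a + b - 1) * Beta a b)"
proof -
  have "has_bochner_integral lborel
          (\<lambda>t. indicator {0..1} t * (t powr (a - 1) * (1 - t) powr (b - 1))) (Beta a b)"
    using integrable_Beta[OF a b] has_integral_Beta_real[OF a b]
    by (simp add: has_bochner_integral_iff set_integrable_def set_borel_integral_eq_integral[OF integrable_Beta[OF a b], unfolded set_lebesgue_integral_def, simplified] integral_unique)
  then have "has_bochner_integral lborel
          (\<lambda>t. x powr (a + b - 2) * (indicator {0..1} t * (t powr (a - 1) * (1 - t) powr (b - 1))))
          (x powr (a + b - 2) * Beta a b)"
    by (rule has_bochner_integral_mult_right)
  moreover have "x powr (a + b - 2) * (indicator {0..1} t * (t powr (a - 1) * (1 - t) powr (b - 1)))
     = indicator {0..x} (0 + x * t) * ((x - (0 + x * t)) powr (b - 1) * (0 + x * t) powr (a - 1))" for t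
  proof (cases "t \<in> {0..1}")
    case True
    have "x - x * t = x * (1 - t)" by (simp add: algebra_simps)
    moreover have "x powr (a + b - 2) = x powr (a - 1) * x powr (b - 1)"
      by (simp add: powr_add[symmetric])
    ultimately show ?thesis using True x by (simp add: powr_mult mult_le_cancel_left1)
  next
    case False
    then show ?thesis using x by (auto simp: indicator_def mult_le_cancel_left1 zero_le_mult_iff)
  qed
  ultimately have "has_bochner_integral lborel
     (\<lambda>t. indicator {0..x} (0 + x * t) * ((x - (0 + x * t)) powr (b - 1) * (0 + x * t) powr (a - 1)))
     (x powr (a + b - 2) * Beta a b)"
    by simp
  moreover have "x powr (a + b - 2) * Beta a b = (x powr (a + b - 1) * Beta a b) /\<^sub>R \<bar>x\<bar>"
    using x by (simp add: powr_diff power2_eq_square field_simps)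
  ultimately show ?thesis
    using x lborel_has_bochner_integral_real_affine_iff[of x
      "\<lambda>t. indicator {0..x} t * ((x - t) powr (b - 1) * t powr (a - 1))"
      "x powr (a + b - 1) * Beta a b" 0]
    by simp
qed

text \<open>Each term integrates to a Beta value, and
  \<open>Beta (A + 2 * n) (lam + 1) \<le> Beta A (lam + 1)\<close>. The integrals of the norms are
  thus dominated by a convergent Bessel series, which permits termwise integration.\<close>

lemma
  fixes \<alpha> lam \<mu> x :: real
  assumes \<alpha>: "\<alpha> > -1" and lam: "lam > -1" and A: "\<alpha> + \<mu> + 1 > 0" and x: "x > 0"
  shows set_integrable_bessel_integrand:
          "set_integrable lborel {0..x} (bessel_integrand \<alpha> lam \<mu> x)" (is ?int)
    and bessel_integral_sums:
          "(\<lambda>n. Gamma (lam + 1) * 2 powr (- \<alpha>) * x powr (\<alpha> + \<mu> + lam + 1) *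
              ((-1) ^ n * Gamma (\<alpha> + \<mu> + 1 + 2 * real n) /
                (fact n * Gamma (\<alpha> + 1 + real n) * Gamma (\<alpha> + \<mu> + lam + 2 + 2 * real n))
               * (x\<^sup>2 / 4) ^ n)) sums
           (LBINT t:{0..x}. bessel_integrand \<alpha> lam \<mu> x t)" (is ?sums)
proof -
  define A where "A = \<alpha> + \<mu> + 1"
  define c where "c = (\<lambda>n. (-1) ^ n / (fact n * Gamma (\<alpha> + 1 + real n)))"
  note sb = summable_bessel_series[OF \<alpha>]
  define e where "e = (\<lambda>n. c n * 2 powr (- \<alpha>) * (1 / 4) ^ n)"
  define f where "f = (\<lambda>n t. indicator {0..x} t * (e n * ((x - t) powr lam * t powr (A + 2 * real n - 1))))"
  define I where "I = (\<lambda>n. x powr (A + 2 * real n + lam) * Beta (A + 2 * real n) (lam + 1))"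
  have A0: "A > 0" using A by (simp add: A_def)
  have hb: "has_bochner_integral lborel (\<lambda>t. indicator {0..x} t * ((x - t) powr lam * t powr (A + 2 * real n - 1)))
              (I n)" for n
    using has_bochner_integral_Beta_scaled[of "A + 2 * real n" "lam + 1" x] A0 lam x
    by (simp add: I_def add_pos_nonneg add.assoc)
  have hf: "has_bochner_integral lborel (f n) (e n * I n)" for n
    using has_bochner_integral_mult_right[OF hb, of "e n" n] by (simp add: f_def mult_ac)
  have hnf: "has_bochner_integral lborel (\<lambda>t. norm (f n t)) (\<bar>e n\<bar> * I n)" for n
    using has_bochner_integral_mult_right[OF hb, of "\<bar>e n\<bar>" n]
    by (simp add: f_def abs_mult mult_ac)
  have term_eq: "e n * I n = Gamma (lam + 1) * 2 powr (- \<alpha>) * x powr (\<alpha> + \<mu> + lam + 1) *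
              ((-1) ^ n * Gamma (\<alpha> + \<mu> + 1 + 2 * real n) /
                (fact n * Gamma (\<alpha> + 1 + real n) * Gamma (\<alpha> + \<mu> + lam + 2 + 2 * real n))
               * (x\<^sup>2 / 4) ^ n)" for n
  proof -
    have "x powr (A + 2 * real n + lam) = x powr (\<alpha> + \<mu> + lam + 1 + real (2 * n))"
      by (simp add: A_def algebra_simps)
    also have "\<dots> = x powr (\<alpha> + \<mu> + lam + 1) * (x\<^sup>2) ^ n"
      using x by (simp only: powr_add powr_realpow power_mult)
    finally have 1: "x powr (A + 2 * real n + lam) = x powr (\<alpha> + \<mu> + lam + 1) * (x\<^sup>2) ^ n" .
    have 2: "A + 2 * real n + (lam + 1) = \<alpha> + \<mu> + lam + 2 + 2 * real n"
      by (simp add: A_def)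
    show ?thesis
      unfolding e_def I_def c_def Beta_def 1 2 by (simp add: A_def power_divide mult_ac)
  qed
  have bnd: "\<bar>e n\<bar> * I n \<le> 2 powr (- \<alpha>) * x powr (A + lam) * Beta A (lam + 1) * (\<bar>c n\<bar> * (x\<^sup>2 / 4) ^ n)" for n
  proof -
    have "Beta (A + 2 * real n) (lam + 1) \<le> Beta A (lam + 1)"
      using A0 lam by (intro Beta_real_mono) auto
    moreover have "x powr (A + 2 * real n + lam) = x powr (A + lam) * (x\<^sup>2) ^ n"
    proof -
      have "x powr (A + 2 * real n + lam) = x powr (A + lam + real (2 * n))"
        by (simp add: algebra_simps)
      then show ?thesis using x by (simp only: powr_add powr_realpow power_mult)
    qed
    ultimately have "I n \<le> x powr (A + lam) * (x\<^sup>2) ^ n * Beta A (lam + 1)"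
      unfolding I_def by (simp add: mult_left_mono)
    then have "\<bar>e n\<bar> * I n \<le> \<bar>e n\<bar> * (x powr (A + lam) * (x\<^sup>2) ^ n * Beta A (lam + 1))"
      by (intro mult_left_mono) auto
    then show ?thesis by (simp add: e_def abs_mult power_divide power_one_over field_simps)
  qed
  have sumI: "summable (\<lambda>n. \<integral>t. norm (f n t) \<partial>lborel)"
  proof -
    have "summable (\<lambda>n. \<bar>e n\<bar> * I n)"
    proof (rule summable_comparison_test')
      show "summable (\<lambda>n. 2 powr (- \<alpha>) * x powr (A + lam) * Beta A (lam + 1) * (\<bar>c n\<bar> * (x\<^sup>2 / 4) ^ n))"
        unfolding c_def by (intro summable_mult sb)
      show "norm (\<bar>e n\<bar> * I n) \<le> 2 powr (- \<alpha>) * x powr (A + lam) * Beta A (lam + 1) * (\<bar>c n\<bar> * (x\<^sup>2 / 4) ^ n)" for n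
      proof -
        have "I n \<ge> 0"
          unfolding I_def Beta_def using A0 lam by (auto intro!: mult_nonneg_nonneg divide_nonneg_nonneg less_imp_le[OF Gamma_real_pos])
        then show ?thesis using bnd[of n] by simp
      qed
    qed
    then show ?thesis using has_bochner_integral_integral_eq[OF hnf] by simp
  qed
  have ptw: "(\<lambda>n. f n t) sums (indicator {0..x} t * bessel_integrand \<alpha> lam \<mu> x t)" 
      and ptwn: "summable (\<lambda>n. norm (f n t))" for t
  proof -
    have ss: "summable (\<lambda>n. \<bar>c n * (t\<^sup>2 / 4) ^ n\<bar>)"
      using sb[of "t\<^sup>2 / 4"] unfolding c_def by (simp add: abs_mult)
    then have s: "summable (\<lambda>n. c n * (t\<^sup>2 / 4) ^ n)" by (rule summable_rabs_cancel)
    \<comment> \<open>\<open>w\<close> collects what does not depend on \<open>n\<close>. At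
      \<open>t = 0\<close> everything vanishes because \<open>0 powr _ = 0\<close>, so the expansion
      holds at every \<open>t\<close>.\<close>
    define w where "w = indicator {0..x} t * ((x - t) powr lam * (t powr (\<mu> + \<alpha>) * 2 powr (-\<alpha>)))"
    have feq: "f n t = w * (c n * (t\<^sup>2 / 4) ^ n)" for n
    proof (cases "t \<in> {0<..x}")
      case True
      have "t powr (A + 2 * real n - 1) = t powr (\<mu> + \<alpha> + real (2 * n))"
        by (simp add: A_def algebra_simps)
      also have "\<dots> = t powr (\<mu> + \<alpha>) * (t\<^sup>2) ^ n"
        using True by (simp only: powr_add powr_realpow power_mult greaterThanAtMost_iff)
      finally show ?thesis by (simp add: f_def e_def w_def power_divide field_simps)
    qed (auto simp: f_def w_def indicator_def)
    have beq: "indicator {0..x} t * bessel_integrand \<alpha> lam \<mu> x t = w * (\<Sum>n. c n * (t\<^sup>2 / 4) ^ n)"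
    proof (cases "t \<in> {0<..x}")
      case True
      have "bessel_J \<alpha> t = (\<Sum>n. t powr \<alpha> * 2 powr (-\<alpha>) * (c n * (t\<^sup>2 / 4) ^ n))"
        unfolding bessel_J_def
      proof (rule suminf_cong)
        fix n
        have "(t / 2) powr (2 * real n + \<alpha>) = (t / 2) powr (\<alpha> + real (2 * n))" by (simp add: add.commute)
        also have "\<dots> = (t / 2) powr \<alpha> * ((t / 2)\<^sup>2) ^ n"
          using True by (simp only: powr_add powr_realpow power_mult half_gt_zero_iff greaterThanAtMost_iff)
        also have "(t / 2) powr \<alpha> = t powr \<alpha> * 2 powr (-\<alpha>)"
          using True by (simp add: powr_divide powr_minus_divide)
        finally have 1: "(t / 2) powr (2 * real n + \<alpha>) = t powr \<alpha> * 2 powr (-\<alpha>) * (t\<^sup>2 / 4) ^ n"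
          by (simp add: power_divide)
        have 2: "rGamma (\<alpha> + real n + 1) = inverse (Gamma (\<alpha> + 1 + real n))"
          by (simp add: Gamma_def add_ac)
        show "(-1) ^ n * rGamma (\<alpha> + real n + 1) / fact n * (t / 2) powr (2 * real n + \<alpha>)
           = t powr \<alpha> * 2 powr (-\<alpha>) * (c n * (t\<^sup>2 / 4) ^ n)"
          unfolding 1 2 by (simp only: c_def divide_inverse inverse_mult_distrib mult_ac)
      qed
      also have "\<dots> = t powr \<alpha> * 2 powr (-\<alpha>) * (\<Sum>n. c n * (t\<^sup>2 / 4) ^ n)"
        by (rule suminf_mult[OF s])
      finally show ?thesis by (simp add: bessel_integrand_def w_def powr_add)
    qed (auto simp: bessel_integrand_def w_def indicator_def)
    show "(\<lambda>n. f n t) sums (indicator {0..x} t * bessel_integrand \<alpha> lam \<mu> x t)"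
      unfolding feq beq by (rule sums_mult[OF summable_sums[OF s]])
    show "summable (\<lambda>n. norm (f n t))"
      unfolding feq using summable_mult[OF ss, of "\<bar>w\<bar>"] by (simp add: abs_mult)
  qed
  have intf: "integrable lborel (f n)" for n using hf by (simp add: has_bochner_integral_iff)
  have eq: "(\<Sum>n. f n t) = indicator {0..x} t * bessel_integrand \<alpha> lam \<mu> x t" for t
    using ptw by (rule sums_unique[symmetric])
  have "integrable lborel (\<lambda>t. \<Sum>n. f n t)"
    using intf ptwn sumI by (intro integrable_suminf) auto
  then show ?int by (simp add: eq set_integrable_def)
  have "(\<lambda>n. integral\<^sup>L lborel (f n)) sums (\<integral>t. (\<Sum>n. f n t) \<partial>lborel)"
    using intf ptwn sumI by (intro sums_integral) auto
  then show ?sums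
    by (simp add: eq has_bochner_integral_integral_eq[OF hf] term_eq set_lebesgue_integral_def)
qed

section \<open>The orders -1/2 and 1/2\<close>

text \<open>By duplication the Gamma factors at half-integers combine with \<open>fact k\<close>
  into the denominators of the cosine and sine series.\<close>

lemma Gamma_half_series_coeff:
  "rGamma (-1/2 + real k + 1) / fact k = 4 ^ k / (sqrt pi * fact (2 * k))"
  "rGamma (1/2 + real k + 1) / fact k = 2 * 4 ^ k / (sqrt pi * fact (2 * k + 1))"
proof -
  have f: "Gamma (1 + real m) = fact m" for m by (simp add: Gamma_fact)
  have "fact (2 * k) = 1 / sqrt pi * 4 ^ k * Gamma (1/2 + real k) * fact k"
    using Gamma_shift_even[of 1 k] f[of "2 * k"] f[of k] by simp
  moreover have "Gamma (1/2 + real k) > 0" by (rule Gamma_shift_pos) simp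
  ultimately show "rGamma (-1/2 + real k + 1) / fact k = 4 ^ k / (sqrt pi * fact (2 * k))"
    by (simp add: rGamma_inverse_Gamma field_simps)
  have "fact (2 * k + 1) = 2 / sqrt pi * 4 ^ k * fact k * Gamma (3/2 + real k)"
    using Gamma_shift_even[of 2 k] f[of "2 * k + 1"] f[of k] by (simp add: add_ac)
  moreover have "Gamma (3/2 + real k) > 0" by (rule Gamma_shift_pos) simp
  moreover have "rGamma (1/2 + real k + 1) = inverse (Gamma (3/2 + real k))"
    by (simp add: rGamma_inverse_Gamma add_ac)
  ultimately show "rGamma (1/2 + real k + 1) / fact k = 2 * 4 ^ k / (sqrt pi * fact (2 * k + 1))"
    by (simp add: field_simps del: fact_Suc)
qed

lemma half_powr_add_even:
  assumes "t > 0"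
  shows "(t / 2) powr (2 * real k + a) = (t / 2) powr a * (t ^ (2 * k) / 4 ^ k)"
proof -
  have "(t / 2) powr (2 * real k + a) = (t / 2) powr a * (t / 2) powr real (2 * k)"
    unfolding powr_add by simp
  also have "(t / 2) powr real (2 * k) = (t / 2) ^ (2 * k)"
    using assms by (intro powr_realpow) simp
  also have "\<dots> = t ^ (2 * k) / 4 ^ k"
    by (simp add: power_divide power_mult)
  finally show ?thesis .
qed

text \<open>The factor \<open>t powr (1/2)\<close> is the \<open>t powr \<mu>\<close> of both
  exceptional integrands.\<close>

lemma bessel_J_minus_half:
  assumes "t > 0"
  shows "t powr (1/2) * bessel_J (-1/2) t = sqrt (2 / pi) * cos t"
proof -
  have "(\<lambda>k. t powr (-1/2) * sqrt (2 / pi) * ((-1) ^ k / fact (2 * k) * t ^ (2 * k))) sums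
         (t powr (-1/2) * sqrt (2 / pi) * cos t)"
    by (intro sums_mult cos_paired)
  moreover have "t powr (-1/2) * sqrt (2 / pi) * ((-1) ^ k / fact (2 * k) * t ^ (2 * k)) =
      (-1) ^ k * rGamma (-1/2 + real k + 1) / fact k * (t / 2) powr (2 * real k + -1/2)" for k
  proof -
    have "(t / 2) powr (2 * real k + -1/2) = (t / 2) powr (-1/2) * (t ^ (2 * k) / 4 ^ k)"
      by (rule half_powr_add_even[OF assms])
    also have "(t / 2) powr (-1/2) = t powr (-1/2) * sqrt 2"
      using assms by (simp add: powr_divide powr_minus powr_half_sqrt divide_simps)
    finally have p: "(t / 2) powr (2 * real k + -1/2) = t powr (-1/2) * sqrt 2 * (t ^ (2 * k) / 4 ^ k)" .
    have "(-1) ^ k * rGamma (-1/2 + real k + 1) / fact k * (t / 2) powr (2 * real k + -1/2)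
       = (-1) ^ k * (4 ^ k / (sqrt pi * fact (2 * k))) * (t powr (-1/2) * sqrt 2 * (t ^ (2 * k) / 4 ^ k))"
      unfolding p Gamma_half_series_coeff(1)[symmetric] by simp
    then show ?thesis by (simp add: real_sqrt_divide)
  qed
  ultimately have "bessel_J (-1/2) t = t powr (-1/2) * sqrt (2 / pi) * cos t"
    by (simp add: bessel_J_def sums_iff)
  moreover have "t powr (1/2) * t powr (-1/2) = 1"
    using assms by (simp add: powr_add[symmetric])
  ultimately show ?thesis by simp
qed

lemma bessel_J_half:
  assumes "t > 0"
  shows "t powr (1/2) * bessel_J (1/2) t = sqrt (2 / pi) * sin t"
proof -
  have "(\<lambda>k. t powr (-1/2) * sqrt (2 / pi) * ((-1) ^ k / fact (2 * k + 1) * t ^ (2 * k + 1))) sums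
         (t powr (-1/2) * sqrt (2 / pi) * sin t)"
    by (intro sums_mult sin_paired)
  moreover have "t powr (-1/2) * sqrt (2 / pi) * ((-1) ^ k / fact (2 * k + 1) * t ^ (2 * k + 1)) =
      (-1) ^ k * rGamma (1/2 + real k + 1) / fact k * (t / 2) powr (2 * real k + 1/2)" for k
  proof -
    have "(t / 2) powr (2 * real k + 1/2) = (t / 2) powr (1/2) * (t ^ (2 * k) / 4 ^ k)"
      by (rule half_powr_add_even[OF assms])
    also have "(t / 2) powr (1/2) = t powr (-1/2) * t * (sqrt 2 / 2)"
    proof -
      have 1: "t powr (-1/2) * t = sqrt t"
        using assms by (simp add: powr_minus powr_half_sqrt divide_simps)
      have 2: "1 / sqrt 2 = sqrt 2 / 2" by (simp add: divide_simps)
      have "(t / 2) powr (1/2) = sqrt t * (1 / sqrt 2)"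
        using assms by (simp add: powr_half_sqrt real_sqrt_divide)
      then show ?thesis by (simp only: 1 2)
    qed
    finally have p: "(t / 2) powr (2 * real k + 1/2) = t powr (-1/2) * t * (sqrt 2 / 2) * (t ^ (2 * k) / 4 ^ k)" .
    have "(-1) ^ k * rGamma (1/2 + real k + 1) / fact k * (t / 2) powr (2 * real k + 1/2)
       = (-1) ^ k * (2 * 4 ^ k / (sqrt pi * fact (2 * k + 1))) * (t powr (-1/2) * t * (sqrt 2 / 2) * (t ^ (2 * k) / 4 ^ k))"
      unfolding p Gamma_half_series_coeff(2)[symmetric] by simp
    then show ?thesis by (simp add: real_sqrt_divide mult_ac del: fact_Suc)
  qed
  ultimately have "bessel_J (1/2) t = t powr (-1/2) * sqrt (2 / pi) * sin t"
    by (simp add: bessel_J_def sums_iff)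
  moreover have "t powr (1/2) * t powr (-1/2) = 1"
    using assms by (simp add: powr_add[symmetric])
  ultimately show ?thesis by simp
qed

section \<open>From majorization to the sign of the integral\<close>

text \<open>A lower bound for all sums of \<open>k\<close> entries is one for the sum of the
  \<open>k\<close> smallest. The majorization thereby becomes a list of linear inequalities, free of
  the order of the entries.\<close>

lemma sum_list_take_sort4:
  fixes a b c d s :: real
  shows "s \<le> a \<Longrightarrow> s \<le> b \<Longrightarrow> s \<le> c \<Longrightarrow> s \<le> d \<Longrightarrow> s \<le> sum_list (take 1 (sort [a, b, c, d]))"
    and "s \<le> a + b \<Longrightarrow> s \<le> a + c \<Longrightarrow> s \<le> a + d \<Longrightarrow> s \<le> b + c \<Longrightarrow> s \<le> b + d \<Longrightarrow> s \<le> c + d \<Longrightarrow>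
           s \<le> sum_list (take 2 (sort [a, b, c, d]))"
    and "s \<le> a + b + c \<Longrightarrow> s \<le> a + b + d \<Longrightarrow> s \<le> a + c + d \<Longrightarrow> s \<le> b + c + d \<Longrightarrow>
           s \<le> sum_list (take 3 (sort [a, b, c, d]))"
    and "s \<le> a + b + c + d \<Longrightarrow> s \<le> sum_list (take 4 (sort [a, b, c, d]))"
  by (auto simp: numeral_eq_Suc)

text \<open>The multisets record the Gamma quotients by which the coefficients of the integral differ
  from those of \<open>J\<^bsub>\<nu>\<^esub>\<^sup>2\<close>, after the duplication formula.\<close>

lemma bessel_integral_sign:
  fixes \<alpha> lam \<mu> \<nu> x :: real
  defines "ps \<equiv> [(\<alpha> + \<mu> + 1) / 2, (\<alpha> + \<mu> + 2) / 2, \<nu> + 1, 2 * \<nu> + 1]"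
    and "qs \<equiv> [(\<alpha> + \<mu> + lam + 2) / 2, (\<alpha> + \<mu> + lam + 3) / 2, \<alpha> + 1, \<nu> + 1/2]"
  assumes \<alpha>: "\<alpha> > -1" and lam: "lam > -1" and A: "\<alpha> + \<mu> + 1 > 0" and \<nu>: "\<nu> > -1/2" and x: "x > 0"
    and ps: "sorted ps"
    and le: "\<And>k. k \<in> {1, 2, 3, 4} \<Longrightarrow> sum_list (take k ps) \<le> sum_list (take k (sort qs))"
  shows "(LBINT t:{0..x}. bessel_integrand \<alpha> lam \<mu> x t) \<ge> 0"
    and "mset ps \<noteq> mset qs \<Longrightarrow> (LBINT t:{0..x}. bessel_integrand \<alpha> lam \<mu> x t) > 0"
proof -
  define c where "c = (\<lambda>n. (-1) ^ n * Gamma (\<nu> + 1/2 + real n) /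
           (fact n * Gamma (\<nu> + 1 + real n) * Gamma (2 * \<nu> + 1 + real n)))"
  define m where "m = Gamma_ratio (mset ps) (mset qs)"
  \<comment> \<open>\<open>C\<close> gathers the factors independent of \<open>n\<close>, among them
    the quotient of the two duplication constants; the two powers \<open>4 ^ n\<close>
    cancel.\<close>
  define C where "C = Gamma (lam + 1) * 2 powr (- \<alpha>) * x powr (\<alpha> + \<mu> + lam + 1) *
     ((2 powr (\<alpha> + \<mu>) / sqrt pi) / (2 powr (\<alpha> + \<mu> + lam + 1) / sqrt pi))"
  have C: "C > 0" unfolding C_def using lam x by (intro mult_pos_pos divide_pos_pos Gamma_real_pos) auto
  have c: "entire_nonneg c" unfolding c_def by (rule entire_nonneg_bessel_square[OF \<nu>])
  have c0: "c 0 > 0" unfolding c_def using \<nu> by (auto intro!: divide_pos_pos mult_pos_pos Gamma_real_pos)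
  have pos: "p > 0" if "p \<in> set ps" for p using that A \<nu> by (auto simp: ps_def)
  have coeff: "Gamma (lam + 1) * 2 powr (- \<alpha>) * x powr (\<alpha> + \<mu> + lam + 1) *
              ((-1) ^ n * Gamma (\<alpha> + \<mu> + 1 + 2 * real n) /
                (fact n * Gamma (\<alpha> + 1 + real n) * Gamma (\<alpha> + \<mu> + lam + 2 + 2 * real n))
               * (x\<^sup>2 / 4) ^ n) = C * (m n * c n * (x\<^sup>2 / 4) ^ n)" for n
  proof -
    have g: "Gamma (\<nu> + 1 + real n) > 0" "Gamma (2 * \<nu> + 1 + real n) > 0" "Gamma (\<nu> + 1/2 + real n) > 0"
      using \<nu> by (auto intro!: Gamma_shift_pos)
    have e1: "Gamma (\<alpha> + \<mu> + 1 + 2 * real n) = 2 powr (\<alpha> + \<mu>) / sqrt pi * 4 ^ n *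
        Gamma ((\<alpha> + \<mu> + 1) / 2 + real n) * Gamma ((\<alpha> + \<mu> + 2) / 2 + real n)"
      using Gamma_shift_even[of "\<alpha> + \<mu> + 1" n] A by (simp add: add.assoc)
    have e2: "Gamma (\<alpha> + \<mu> + lam + 2 + 2 * real n) = 2 powr (\<alpha> + \<mu> + lam + 1) / sqrt pi * 4 ^ n *
        Gamma ((\<alpha> + \<mu> + lam + 2) / 2 + real n) * Gamma ((\<alpha> + \<mu> + lam + 3) / 2 + real n)"
    proof -
      have "\<alpha> + \<mu> + lam + 2 - 1 = \<alpha> + \<mu> + lam + 1" "\<alpha> + \<mu> + lam + 2 + 1 = \<alpha> + \<mu> + lam + 3" by auto
      with Gamma_shift_even[of "\<alpha> + \<mu> + lam + 2" n] A lam show ?thesis by simp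
    qed
    have m: "m n = Gamma ((\<alpha> + \<mu> + 1) / 2 + real n) * Gamma ((\<alpha> + \<mu> + 2) / 2 + real n) *
         Gamma (\<nu> + 1 + real n) * Gamma (2 * \<nu> + 1 + real n) /
         (Gamma ((\<alpha> + \<mu> + lam + 2) / 2 + real n) * Gamma ((\<alpha> + \<mu> + lam + 3) / 2 + real n) *
          Gamma (\<alpha> + 1 + real n) * Gamma (\<nu> + 1/2 + real n))"
      unfolding m_def Gamma_ratio_def ps_def qs_def by (simp only: mset.simps image_mset_add_mset prod_mset.add_mset image_mset_empty prod_mset_empty mult_1_right mult.assoc)
    have cancel: "M * (s * (K * p * a1 * a2) / (F * l * (L * p * b1 * b2)) * Y)
        = M * (K / L) * (a1 * a2 * v1 * v2 / (b1 * b2 * l * h) * (s * h / (F * v1 * v2)) * Y)"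
      if "v1 \<noteq> 0" "v2 \<noteq> 0" "h \<noteq> 0" "p \<noteq> 0"
      for M s K p a1 a2 F l L b1 b2 Y v1 v2 h :: real
    proof -
      have "M * (K / L) * (a1 * a2 * v1 * v2 / (b1 * b2 * l * h) * (s * h / (F * v1 * v2)) * Y)
        = M * (K / L) * (a1 * a2 / (b1 * b2 * l) * (s / F) * Y)"
        using that by simp
      moreover have "M * (s * (K * p * a1 * a2) / (F * l * (L * p * b1 * b2)) * Y)
        = M * (K / L) * (a1 * a2 / (b1 * b2 * l) * (s / F) * Y)"
        using that(4) by (simp add: mult_ac)
      ultimately show ?thesis by simp
    qed
    show ?thesis
      unfolding e1 e2 C_def m c_def using g by (intro cancel) auto
  qed
  have mc: "(\<lambda>n. C * (m n * c n * (x\<^sup>2 / 4) ^ n)) sums (LBINT t:{0..x}. bessel_integrand \<alpha> lam \<mu> x t)"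
    using bessel_integral_sums[OF \<alpha> lam A x] unfolding coeff .
  \<comment> \<open>The order of \<open>qs\<close> varies with the parameters; sorting leaves its
    multiset and hence \<open>m\<close> unchanged.\<close>
  have mult: "mset ps = mset (sort qs) \<or> strict_multiplier (Gamma_ratio (mset ps) (mset (sort qs)))"
  proof (rule strict_multiplier_Gamma_ratio[OF ps])
    fix k assume "k \<le> length ps"
    then have "k \<in> {0, 1, 2, 3, 4}" by (auto simp: ps_def)
    then show "sum_list (take k ps) \<le> sum_list (take k (sort qs))"
      using le by (cases "k = 0") auto
  qed (use pos in \<open>auto simp: ps_def qs_def simp del: sort_key_simps\<close>)
  then have "pos_multiplier m"
    using pos_multiplier_Gamma_ratio_self[of "mset ps"] pos
    by (auto simp: m_def strict_multiplier_def)
  then have nn: "entire_nonneg (\<lambda>n. m n * c n)" using c by (simp add: pos_multiplier_def)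
  have val: "(LBINT t:{0..x}. bessel_integrand \<alpha> lam \<mu> x t) = C * (\<Sum>n. m n * c n * (x\<^sup>2 / 4) ^ n)"
    using mc entire_nonneg_summable[OF nn] by (simp add: sums_iff suminf_mult)
  show "(LBINT t:{0..x}. bessel_integrand \<alpha> lam \<mu> x t) \<ge> 0"
    unfolding val using nn C by (auto simp: entire_nonneg_def)
  assume "mset ps \<noteq> mset qs"
  with mult have "strict_multiplier m" by (simp add: m_def)
  with c c0 have "entire_pos (\<lambda>n. m n * c n)" by (simp add: strict_multiplier_def)
  then show "(LBINT t:{0..x}. bessel_integrand \<alpha> lam \<mu> x t) > 0"
    unfolding val using C by (auto simp: entire_pos_def)
qed

section \<open>The two exceptional integrals\<close>

lemma LBINT_sin:
  assumes "x \<ge> (0::real)"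
  shows "(LBINT t:{0..x}. sin t) = 1 - cos x"
proof -
  have "(LBINT t. sin t * indicator {0..x} t) = - cos x - - cos 0"
    by (rule integral_FTC_Icc_real[where F = "\<lambda>t. - cos t"])
      (use assms in \<open>auto intro!: derivative_eq_intros\<close>)
  then show ?thesis by (simp add: set_lebesgue_integral_def mult.commute)
qed

lemma LBINT_linear_cos:
  assumes "x \<ge> (0::real)"
  shows "(LBINT t:{0..x}. (x - t) * cos t) = 1 - cos x"
proof -
  have "(LBINT t. (x - t) * cos t * indicator {0..x} t)
      = ((x - x) * sin x - cos x) - ((x - 0) * sin 0 - cos 0)"
    by (rule integral_FTC_Icc_real[where F = "\<lambda>t. (x - t) * sin t - cos t"])
      (use assms in \<open>auto intro!: derivative_eq_intros\<close>)
  then show ?thesis by (simp add: set_lebesgue_integral_def mult_ac)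
qed

lemma LBINT_cong_greaterThanLessThan:
  fixes f g :: "real \<Rightarrow> real"
  assumes "set_integrable lborel {a..b} f" "continuous_on {a..b} g"
    and eq: "\<And>t. a < t \<Longrightarrow> t < b \<Longrightarrow> f t = g t"
  shows "(LBINT t:{a..b}. f t) = (LBINT t:{a..b}. g t)"
  unfolding set_lebesgue_integral_def
proof (rule integral_cong_AE)
  show "(\<lambda>t. indicator {a..b} t *\<^sub>R f t) \<in> borel_measurable lborel"
    using assms(1) by (auto simp: set_integrable_def)
  show "(\<lambda>t. indicator {a..b} t *\<^sub>R g t) \<in> borel_measurable lborel"
    using borel_integrable_atLeastAtMost'[OF assms(2)] by (auto simp: set_integrable_def)
  show "AE t in lborel. indicator {a..b} t *\<^sub>R f t = indicator {a..b} t *\<^sub>R g t"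
    using AE_lborel_singleton[of a] AE_lborel_singleton[of b]
  proof eventually_elim
    case (elim t)
    then show ?case using eq[of t] by (cases "t \<in> {a..b}") auto
  qed
qed

lemma bessel_integral_cos:
  assumes "x > 0"
  shows "(LBINT t:{0..x}. bessel_integrand (-1/2) 1 (1/2) x t) = sqrt (2 / pi) * (1 - cos x)"
proof -
  have "(LBINT t:{0..x}. bessel_integrand (-1/2) 1 (1/2) x t)
      = (LBINT t:{0..x}. sqrt (2 / pi) * ((x - t) * cos t))"
  proof (rule LBINT_cong_greaterThanLessThan)
    show "bessel_integrand (-1/2) 1 (1/2) x t = sqrt (2 / pi) * ((x - t) * cos t)"
      if "0 < t" "t < x" for t
    proof -
      have "bessel_integrand (-1/2) 1 (1/2) x t = (x - t) * (t powr (1/2) * bessel_J (-1/2) t)"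
        using that by (simp add: bessel_integrand_def)
      then show ?thesis using bessel_J_minus_half[of t] that by simp
    qed
  qed (use assms in \<open>auto intro!: set_integrable_bessel_integrand continuous_intros\<close>)
  then show ?thesis using assms by (simp add: LBINT_linear_cos)
qed

lemma bessel_integral_sin:
  assumes "x > 0"
  shows "(LBINT t:{0..x}. bessel_integrand (1/2) 0 (1/2) x t) = sqrt (2 / pi) * (1 - cos x)"
proof -
  have "(LBINT t:{0..x}. bessel_integrand (1/2) 0 (1/2) x t)
      = (LBINT t:{0..x}. sqrt (2 / pi) * sin t)"
  \<comment> \<open>At \<open>t = x\<close> the factor \<open>(x - t) powr 0\<close> is 0 and not 1,
    so the integrands are compared only inside the interval.\<close>
  proof (rule LBINT_cong_greaterThanLessThan)
    show "bessel_integrand (1/2) 0 (1/2) x t = sqrt (2 / pi) * sin t"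
      if "0 < t" "t < x" for t
      using bessel_J_half[of t] that by (simp add: bessel_integrand_def)
  qed (use assms in \<open>auto intro!: set_integrable_bessel_integrand continuous_intros\<close>)
  then show ?thesis using assms by (simp add: LBINT_sin)
qed

section \<open>Choice of the auxiliary order \<nu> over the parameter region\<close>

theorem theorem9p1:
  fixes \<alpha> lam \<mu> :: real
  assumes "\<alpha> > -1"
    and "(\<alpha> \<le> -1/2 \<and> lam \<ge> -1/2 \<and> -\<alpha> - 1 < \<mu> \<and> \<mu> \<le> min (\<alpha> + 1) (lam + \<alpha>))
       \<or> (\<alpha> \<ge> -1/2 \<and> lam \<ge> -1/2 \<and>
           ((-\<alpha> - 1 < \<mu> \<and> \<mu> \<le> min (-\<alpha>) (lam - 1/2))
          \<or> (-\<alpha> \<le> \<mu> \<and>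
             \<mu> \<le> Min {\<alpha> + 1, lam + \<alpha>, lam + 1/2, 2 * lam + 1/2, 1/2 * (lam + \<alpha> + 1/2)})))"
  shows "(\<forall>x>0. set_integrable lborel {0..x} (bessel_integrand \<alpha> lam \<mu> x)
              \<and> (LBINT t:{0..x}. bessel_integrand \<alpha> lam \<mu> x t) \<ge> 0)
       \<and> ((\<alpha>, lam, \<mu>) \<noteq> (-1/2, 1, 1/2) \<and> (\<alpha>, lam, \<mu>) \<noteq> (1/2, 0, 1/2) \<longrightarrow>
            (\<forall>x>0. (LBINT t:{0..x}. bessel_integrand \<alpha> lam \<mu> x t) > 0))
       \<and> ((\<alpha>, lam, \<mu>) = (-1/2, 1, 1/2) \<or> (\<alpha>, lam, \<mu>) = (1/2, 0, 1/2) \<longrightarrow>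
            (\<forall>x>0.
               (LBINT t:{0..x}. bessel_integrand \<alpha> lam \<mu> x t)
                 = sqrt (2 / pi) * (LBINT t:{0..x}. (x - t) * cos t)
             \<and> sqrt (2 / pi) * (LBINT t:{0..x}. (x - t) * cos t)
                 = sqrt (2 / pi) * (LBINT t:{0..x}. sin t)
             \<and> sqrt (2 / pi) * (LBINT t:{0..x}. sin t)
                 = 2 * sqrt (2 / pi) * (sin (x / 2))\<^sup>2))"
proof -
  define ps where "ps = (\<lambda>\<nu>. [(\<alpha> + \<mu> + 1) / 2, (\<alpha> + \<mu> + 2) / 2, \<nu> + 1, 2 * \<nu> + 1])"
  define qs where "qs = (\<lambda>\<nu>. [(\<alpha> + \<mu> + lam + 2) / 2, (\<alpha> + \<mu> + lam + 3) / 2, \<alpha> + 1, \<nu> + 1/2])"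
  define exceptional where
    "exceptional \<longleftrightarrow> (\<alpha>, lam, \<mu>) = (-1/2, 1, 1/2) \<or> (\<alpha>, lam, \<mu>) = (1/2, 0, 1/2)"
  \<comment> \<open>These are the demands of \<open>bessel_integral_sign\<close> on the auxiliary
    order; the last conjunct ties a failure of strictness to the exceptional triples.\<close>
  define adm where "adm = (\<lambda>\<nu>. \<nu> > -1/2 \<and> sorted (ps \<nu>) \<and>
      (\<forall>k\<in>{1, 2, 3, 4}. sum_list (take k (ps \<nu>)) \<le> sum_list (take k (sort (qs \<nu>)))) \<and>
      (mset (ps \<nu>) = mset (qs \<nu>) \<longrightarrow> exceptional))"
  have \<alpha>: "\<alpha> > -1" by (rule assms(1))
  have lam: "lam \<ge> -1/2" using assms(2) by blast
  have A: "\<alpha> + \<mu> + 1 > 0" using assms by auto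
  have prefix_sums: "sum_list (take 1 (ps \<nu>)) = (\<alpha> + \<mu> + 1) / 2"
    "sum_list (take 2 (ps \<nu>)) = \<alpha> + \<mu> + 3/2"
    "sum_list (take 3 (ps \<nu>)) = \<alpha> + \<mu> + \<nu> + 5/2"
    "sum_list (take 4 (ps \<nu>)) = \<alpha> + \<mu> + 3 * \<nu> + 7/2" for \<nu>
    by (simp_all add: ps_def field_simps)
  have "\<exists>\<nu>. adm \<nu>"
  proof (cases "\<alpha> \<ge> -1/2 \<and> -\<alpha> \<le> \<mu> \<and> \<mu> \<le> \<alpha> + 1 \<and> \<mu> \<le> lam + \<alpha> \<and> \<mu> \<le> lam + 1/2 \<and>
              \<mu> \<le> 2 * lam + 1/2 \<and> 2 * \<mu> \<le> lam + \<alpha> + 1/2")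
    case True
    then have \<mu>: "-\<alpha> \<le> \<mu>" "\<mu> \<le> \<alpha> + 1" "\<mu> \<le> lam + \<alpha>" "\<mu> \<le> lam + 1/2"
        "\<mu> \<le> 2 * lam + 1/2" "2 * \<mu> \<le> lam + \<alpha> + 1/2"
      by auto
    \<comment> \<open>This choice makes the sums of \<open>ps \<nu>\<close> and \<open>qs \<nu>\<close> equal.\<close>
    define \<nu> where "\<nu> = (lam + \<alpha>) / 2 + 1/4"
    have \<nu>: "4 * \<nu> = 2 * lam + 2 * \<alpha> + 1" by (simp add: \<nu>_def)
    note facts = \<mu> lam A \<nu>
    have "adm \<nu>"
      unfolding adm_def
    proof (intro conjI ballI impI)
      \<comment> \<open>The second entry precedes the third exactly when
        \<open>\<mu> \<le> lam + 1/2\<close>.\<close>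
      show "sorted (ps \<nu>)" unfolding ps_def using facts by auto
      show "\<nu> > -1/2" using facts by linarith
      fix k :: nat assume "k \<in> {1, 2, 3, 4}"
      \<comment> \<open>The bounds enter as follows: \<open>\<mu> \<le> \<alpha> + 1\<close> for
        \<open>k = 1\<close>; \<open>\<mu> \<le> 2 * lam + 1/2\<close> and
        \<open>2 * \<mu> \<le> lam + \<alpha> + 1/2\<close> for \<open>k = 2\<close>. As the totals
        agree, \<open>k = 3\<close> says that \<open>2 * \<nu> + 1\<close> dominates
        \<open>qs \<nu>\<close>, which rests on \<open>\<mu> \<le> lam + \<alpha>\<close> and
        \<open>lam \<ge> -1/2\<close>.\<close>
      moreover have "sum_list (take 1 (ps \<nu>)) \<le> sum_list (take 1 (sort (qs \<nu>)))"
        unfolding qs_def prefix_sums add_divide_distrib using facts by (intro sum_list_take_sort4) linarith+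
      moreover have "sum_list (take 2 (ps \<nu>)) \<le> sum_list (take 2 (sort (qs \<nu>)))"
        unfolding qs_def prefix_sums add_divide_distrib using facts by (intro sum_list_take_sort4) linarith+
      moreover have "sum_list (take 3 (ps \<nu>)) \<le> sum_list (take 3 (sort (qs \<nu>)))"
        unfolding qs_def prefix_sums add_divide_distrib using facts by (intro sum_list_take_sort4) linarith+
      moreover have "sum_list (take 4 (ps \<nu>)) \<le> sum_list (take 4 (sort (qs \<nu>)))"
        unfolding qs_def prefix_sums add_divide_distrib using facts by (intro sum_list_take_sort4) linarith+
      ultimately show "sum_list (take k (ps \<nu>)) \<le> sum_list (take k (sort (qs \<nu>)))" by blast
    next
      assume "mset (ps \<nu>) = mset (qs \<nu>)"
      then have "set (ps \<nu>) = set (qs \<nu>)" by (metis set_mset_mset)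
      then have "(\<alpha> + \<mu> + 1) / 2 \<in> {(\<alpha> + \<mu> + lam + 2) / 2, (\<alpha> + \<mu> + lam + 3) / 2, \<alpha> + 1, \<nu> + 1/2}"
          "(\<alpha> + \<mu> + 2) / 2 \<in> {(\<alpha> + \<mu> + lam + 2) / 2, (\<alpha> + \<mu> + lam + 3) / 2, \<alpha> + 1, \<nu> + 1/2}"
          "(\<alpha> + \<mu> + lam + 2) / 2 \<in> {(\<alpha> + \<mu> + 1) / 2, (\<alpha> + \<mu> + 2) / 2, \<nu> + 1, 2 * \<nu> + 1}"
          "(\<alpha> + \<mu> + lam + 3) / 2 \<in> {(\<alpha> + \<mu> + 1) / 2, (\<alpha> + \<mu> + 2) / 2, \<nu> + 1, 2 * \<nu> + 1}"
        unfolding ps_def qs_def list.set by blast+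
      \<comment> \<open>Each combination of the memberships is a linear system that either
        contradicts the bounds or forces one of the two triples.\<close>
      then have "\<alpha> = -1/2 \<and> lam = 1 \<and> \<mu> = 1/2 \<or> \<alpha> = 1/2 \<and> lam = 0 \<and> \<mu> = 1/2"
        using facts
        unfolding insert_iff empty_iff add_divide_distrib
        by (elim disjE)
          (rule FalseE, linarith | (rule disjI1, intro conjI; linarith) | (rule disjI2, intro conjI; linarith))+
      then show exceptional unfolding exceptional_def by auto
    qed
    then show ?thesis ..
  next
    case False
    \<comment> \<open>For \<open>\<alpha> \<le> -1/2\<close> the third bound follows from
      \<open>lam + \<alpha> \<le> lam - 1/2\<close>. For \<open>\<alpha> \<ge> -1/2\<close> and
      \<open>\<mu> \<le> -\<alpha>\<close> the first two follow from
      \<open>-\<alpha> \<le> \<alpha> + 1\<close> and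
      \<open>lam - 1/2 \<le> lam + \<alpha>\<close>.\<close>
    then have \<mu>: "\<mu> \<le> \<alpha> + 1" "\<mu> \<le> lam + \<alpha>" "\<mu> \<le> lam - 1/2"
      using assms(2) by auto
    \<comment> \<open>Now \<open>(\<alpha> + \<mu> + 2) / 2 = \<nu> + 1/2\<close> is common to \<open>ps \<nu>\<close> and \<open>qs \<nu>\<close>.\<close>
    define \<nu> where "\<nu> = (\<alpha> + \<mu> + 1) / 2"
    have \<nu>: "2 * \<nu> = \<alpha> + \<mu> + 1" by (simp add: \<nu>_def)
    note facts = \<mu> lam A \<nu>
    have "adm \<nu>"
      unfolding adm_def
    proof (intro conjI ballI impI)
      show "sorted (ps \<nu>)" unfolding ps_def using facts by auto
      show "\<nu> > -1/2" using facts by linarith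
      fix k :: nat assume "k \<in> {1, 2, 3, 4}"
      \<comment> \<open>With the common entry cancelled, one entry compares by
        \<open>\<mu> \<le> \<alpha> + 1\<close>, two by \<open>lam \<ge> -1/2\<close> and
        \<open>\<mu> \<le> lam + \<alpha>\<close>, and the totals by
        \<open>\<mu> \<le> lam - 1/2\<close>.\<close>
      moreover have "sum_list (take 1 (ps \<nu>)) \<le> sum_list (take 1 (sort (qs \<nu>)))"
        unfolding qs_def prefix_sums add_divide_distrib using facts by (intro sum_list_take_sort4) linarith+
      moreover have "sum_list (take 2 (ps \<nu>)) \<le> sum_list (take 2 (sort (qs \<nu>)))"
        unfolding qs_def prefix_sums add_divide_distrib using facts by (intro sum_list_take_sort4) linarith+
      moreover have "sum_list (take 3 (ps \<nu>)) \<le> sum_list (take 3 (sort (qs \<nu>)))"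
        unfolding qs_def prefix_sums add_divide_distrib using facts by (intro sum_list_take_sort4) linarith+
      moreover have "sum_list (take 4 (ps \<nu>)) \<le> sum_list (take 4 (sort (qs \<nu>)))"
        unfolding qs_def prefix_sums add_divide_distrib using facts by (intro sum_list_take_sort4) linarith+
      ultimately show "sum_list (take k (ps \<nu>)) \<le> sum_list (take k (sort (qs \<nu>)))" by blast
    next
      assume "mset (ps \<nu>) = mset (qs \<nu>)"
      then have "set (ps \<nu>) = set (qs \<nu>)" by (metis set_mset_mset)
      then have "(\<alpha> + \<mu> + 1) / 2 \<in> {(\<alpha> + \<mu> + lam + 2) / 2, (\<alpha> + \<mu> + lam + 3) / 2, \<alpha> + 1, \<nu> + 1/2}"
          "\<nu> + 1 \<in> {(\<alpha> + \<mu> + lam + 2) / 2, (\<alpha> + \<mu> + lam + 3) / 2, \<alpha> + 1, \<nu> + 1/2}"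
          "2 * \<nu> + 1 \<in> {(\<alpha> + \<mu> + lam + 2) / 2, (\<alpha> + \<mu> + lam + 3) / 2, \<alpha> + 1, \<nu> + 1/2}"
        unfolding ps_def qs_def list.set by blast+
      then have "\<alpha> = -1/2 \<and> lam = 1 \<and> \<mu> = 1/2 \<or> \<alpha> = 1/2 \<and> lam = 0 \<and> \<mu> = 1/2"
        using facts
        unfolding insert_iff empty_iff add_divide_distrib
        by (elim disjE)
          (rule FalseE, linarith | (rule disjI1, intro conjI; linarith) | (rule disjI2, intro conjI; linarith))+
      then show exceptional unfolding exceptional_def by auto
    qed
    then show ?thesis ..
  qed
  then obtain \<nu> where \<nu>: "adm \<nu>" ..
  have lam': "lam > -1" using lam by simp
  have sign: "(LBINT t:{0..x}. bessel_integrand \<alpha> lam \<mu> x t) \<ge> 0"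
    "mset (ps \<nu>) \<noteq> mset (qs \<nu>) \<Longrightarrow> (LBINT t:{0..x}. bessel_integrand \<alpha> lam \<mu> x t) > 0" if "x > 0" for x
    using bessel_integral_sign[OF \<alpha> lam' A _ that, of \<nu>] \<nu>
    unfolding adm_def ps_def qs_def by blast+
  have int: "set_integrable lborel {0..x} (bessel_integrand \<alpha> lam \<mu> x)" if "x > 0" for x
    by (rule set_integrable_bessel_integrand[OF \<alpha> lam' A that])
  have half: "sqrt (2 / pi) * (1 - cos x) = 2 * sqrt (2 / pi) * (sin (x / 2))\<^sup>2" for x
    using cos_double_sin[of "x / 2"] by simp
  show ?thesis
  proof (intro conjI allI impI)
    show "(LBINT t:{0..x}. bessel_integrand \<alpha> lam \<mu> x t) > 0"
      if "(\<alpha>, lam, \<mu>) \<noteq> (-1/2, 1, 1/2) \<and> (\<alpha>, lam, \<mu>) \<noteq> (1/2, 0, 1/2)" "x > 0" for x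
      using sign(2)[OF that(2)] \<nu> that(1) unfolding adm_def exceptional_def by blast
    show "(LBINT t:{0..x}. bessel_integrand \<alpha> lam \<mu> x t)
                 = sqrt (2 / pi) * (LBINT t:{0..x}. (x - t) * cos t)"
      if "(\<alpha>, lam, \<mu>) = (-1/2, 1, 1/2) \<or> (\<alpha>, lam, \<mu>) = (1/2, 0, 1/2)" "x > 0" for x
      using that(1) unfolding prod.inject
      by (elim disjE conjE) (simp_all only: bessel_integral_cos[OF that(2)] bessel_integral_sin[OF that(2)]
            LBINT_linear_cos[OF less_imp_le[OF that(2)]])
  qed (use int sign(1) in \<open>simp_all add: LBINT_linear_cos LBINT_sin half\<close>)
qed

end
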